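(* Suppose that the following assumptions hold. (1) (Balanced panel of groups) $N_{g,t}>0$ for all $(g,t)\in\{1,\dots,G\}\times\{1,\dots,T\}$. (2) (Sharp design) $D_{i,g,t}=D_{g,t}$ for all $(g,t)$ and all $i\in\{1,\dots,N_{g,t}\}$. (3) (Independent groups) The vectors $(Y_{g,t}(0),Y_{g,t}(1),D_{g,t})_{1\le t\le T}$, $g=1,\dots,G$, are mutually independent. (4) (Strong exogeneity) For all $g\in\{1,\dots,G\}$ and $t\in\{2,\dots,T\}$, $E(Y_{g,t}(0)-Y_{g,t-1}(0)\mid D_{g,1},\dots,D_{g,T})=E(Y_{g,t}(0)-Y_{g,t-1}(0))$. (5) (Common trends) For every $t\in\{2,\dots,T\}$, $E(Y_{g,t}(0)-Y_{g,t-1}(0))$ does not vary across $g$. Fix any realization of $\boldsymbol D$ having positive probability; all quantities below are evaluated at this realization. 1. If $\sigma(\boldsymbol w)>0$, the minimal value of $\sigma(\widetilde{\boldsymbol\Delta})$ compatible with $\widetilde\beta_{fe}$ and $\widetilde\Delta^{TR}=0$ is $$\underline\sigma_{fe}=\frac{|\widetilde\beta_{fe}|}{\sigma(\boldsymbol w)}.$$ That is: (a) if $\widetilde\Delta^{TR}=0$ then $\sigma(\widetilde{\boldsymbol\Delta})\ge\underline\sigma_{fe}$; and (b) there is a collection of reals $\boldsymbol x=(x_{g,t})$ with $\sum_{(g,t):D_{g,t}=1}\frac{N_{g,t}}{N_1}w_{g,t}x_{g,t}=\widetilde\beta_{fe}$, $m(\boldsymbol x)=0$ and $\sigma(\boldsymbol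 x)=\underline\sigma_{fe}$. 2. If $\widetilde\beta_{fe}\neq0$ and at least one of the weights $w_{g,t}$ of the treated cells is strictly negative, the minimal value of $\sigma(\widetilde{\boldsymbol\Delta})$ compatible with $\widetilde\beta_{fe}$ and with $\widetilde\Delta_{g,t}$ of a different sign than $\widetilde\beta_{fe}$ for all $(g,t)$ is $$\underline{\underline\sigma}_{fe}=\frac{|\widetilde\beta_{fe}|}{\left[T_s+S_s^2/(1-P_s)\right]^{1/2}},\qquad s=\min\left\{i\in\{1,\dots,n\}:\ w_{(i)}<-\frac{S_i}{1-P_i}\right\}.$$ That is: (a) if $\widetilde\Delta_{g,t}$ is of a different sign than $\widetilde\beta_{fe}$ for all $(g,t)$, then $\sigma(\widetilde{\boldsymbol\Delta})\ge\underline{\underline\sigma}_{fe}$; and (b) there is a collection of reals $\boldsymbol x=(x_{g,t})$, with $x_{g,t}$ of a different sign than $\widetilde\beta_{fe}$ for all $(g,t)$, such that $\sum_{(g,t):D_{g,t}=1}\frac{N_{g,t}}{N_1}w_{g,t}x_{g,t}=\widetilde\beta_{fe}$ and $\sigma(\boldsymbol x)=\underline{\underline\sigma}_{fe}$.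
   Context: Setting. There are $G$ groups and $T$ periods; $N_{g,t}$ is the (non-random) number of observations in cell $(g,t)\in\{1,\dots,G\}\times\{1,\dots,T\}$. Observation $i\in\{1,\dots,N_{g,t}\}$ of cell $(g,t)$ has a binary treatment $D_{i,g,t}\in\{0,1\}$, potential outcomes $Y_{i,g,t}(0),Y_{i,g,t}(1)$ and observed outcome $Y_{i,g,t}=Y_{i,g,t}(D_{i,g,t})$. Treatments and potential outcomes are random variables, and potential outcomes have finite expectations. Cell averages: $D_{g,t}=\frac1{N_{g,t}}\sum_i D_{i,g,t}$, $Y_{g,t}(d)=\frac1{N_{g,t}}\sum_i Y_{i,g,t}(d)$ for $d\in\{0,1\}$, $Y_{g,t}=\frac1{N_{g,t}}\sum_i Y_{i,g,t}$. $\boldsymbol D=(D_{g,t})_{(g,t)\in\{1,\dots,G\}\times\{1,\dots,T\}}$; $\Delta_{g,t}=\frac1{N_{g,t}}\sum_{i}[Y_{i,g,t}(1)-Y_{i,g,t}(0)]$; $N_1=\sum_{i,g,t}D_{i,g,t}$; $\Delta^{TR}=\frac1{N_1}\sum_{(i,g,t):D_{g,t}=1}[Y_{i,g,t}(1)-Y_{i,g,t}(0)]$. Regression. $\widehat\beta_{fe}$ is the coefficient of $D_{g,t}$ in the observation-level OLS regression of $Y_{i,g,t}$ on group fixed effects, period fixed effects and $D_{g,t}$ (equivalently, the cell-level regression of $Y_{g,t}$ on the same regressors weighted by $N_{g,t}$). Standing assumption: (almost surely) $D_{g,t}$ is not collinear with the group and period fixed effects. Weights. $\varepsilon_{g,t}$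 is the residual of cell $(g,t)$ in the observation-level OLS regression (cells weighted by $N_{g,t}$) of $D_{g,t}$ on group and period fixed effects, and $w_{g,t}=\varepsilon_{g,t}\Big/\sum_{(g',t'):D_{g',t'}=1}\frac{N_{g',t'}}{N_1}\varepsilon_{g',t'}$ (the denominator is nonzero under non-collinearity). Conditional quantities: $\widetilde\Delta_{g,t}=E(\Delta_{g,t}\mid\boldsymbol D)$, $\widetilde\Delta^{TR}=E(\Delta^{TR}\mid\boldsymbol D)$, $\widetilde\beta_{fe}=E(\widehat\beta_{fe}\mid\boldsymbol D)$. For a collection of reals $\boldsymbol x=(x_{g,t})_{(g,t)\in\{1,\dots,G\}\times\{1,\dots,T\}}$ put $m(\boldsymbol x)=\sum_{(g,t):D_{g,t}=1}\frac{N_{g,t}}{N_1}x_{g,t}$ and $\sigma(\boldsymbol x)=\left(\sum_{(g,t):D_{g,t}=1}\frac{N_{g,t}}{N_1}(x_{g,t}-m(\boldsymbol x))^2\right)^{1/2}$; thus $\sigma(\widetilde{\boldsymbol\Delta})=\left(\sum_{(g,t):D_{g,t}=1}\frac{N_{g,t}}{N_1}(\widetilde\Delta_{g,t}-\widetilde\Delta^{TR})^2\right)^{1/2}$ and $\sigma(\boldsymbol w)=\left(\sum_{(g,t):D_{g,t}=1}\frac{N_{g,t}}{N_1}(w_{g,t}-1)^2\right)^{1/2}$ (the mean of $\boldsymbol w$ over treated cells being 1). "A real $x$ is of a different sign than $b\neq0$" means $x\le0$ if $b>0$ and $x\ge0$ if $b<0$. Ordered weights. $n=\#\{(g,t):D_{g,t}=1\}$;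 $w_{(1)}\ge w_{(2)}\ge\dots\ge w_{(n)}$ are the weights of the treated cells in decreasing order, and $N_{(i)}$ is the number of observations of the cell corresponding to $w_{(i)}$. For $k\in\{1,\dots,n\}$: $P_k=\sum_{i\ge k}N_{(i)}/N_1$, $S_k=\sum_{i\ge k}(N_{(i)}/N_1)w_{(i)}$, $T_k=\sum_{i\ge k}(N_{(i)}/N_1)w_{(i)}^2$. Since $P_1=1$ and $S_1=1$, the ratio $-S_1/(1-P_1)$ is read as $-\infty$, i.e. the index $i=1$ does not satisfy the inequality defining $s$. *)

theory Defs
  imports "HOL-Probability.Probability"
begin

text \<open>
  Groups are \<open>1..G\<close>, periods \<open>1..T\<close>, and the observations of cell \<open>(g, t)\<close> are \<open>1..N g t\<close>.
  The treatment of observation \<open>i\<close> of cell \<open>(g, t)\<close> is a boolean random variable \<open>D i g t\<close>,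
  its potential outcomes are \<open>Y i g t True\<close> and \<open>Y i g t False\<close>. The letter \<open>d\<close> stands for a
  realization \<open>d g t\<close> of the array of cell averages of the treatment.
\<close>

definition cell_avg ::
    "(nat \<Rightarrow> nat \<Rightarrow> nat) \<Rightarrow> (nat \<Rightarrow> nat \<Rightarrow> nat \<Rightarrow> 'a \<Rightarrow> real) \<Rightarrow> nat \<Rightarrow> nat \<Rightarrow> 'a \<Rightarrow> real" where
  "cell_avg N f g t \<omega> = (\<Sum>i = 1..N g t. f i g t \<omega>) / real (N g t)"

definition treat_avg ::
    "(nat \<Rightarrow> nat \<Rightarrow> nat) \<Rightarrow> (nat \<Rightarrow> nat \<Rightarrow> nat \<Rightarrow> 'a \<Rightarrow> bool) \<Rightarrow> nat \<Rightarrow> nat \<Rightarrow> 'a \<Rightarrow> real" where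
  "treat_avg N D = cell_avg N (\<lambda>i g t \<omega>. of_bool (D i g t \<omega>))"

definition pot_avg ::
    "(nat \<Rightarrow> nat \<Rightarrow> nat) \<Rightarrow> (nat \<Rightarrow> nat \<Rightarrow> nat \<Rightarrow> bool \<Rightarrow> 'a \<Rightarrow> real) \<Rightarrow> bool \<Rightarrow> nat \<Rightarrow> nat \<Rightarrow> 'a \<Rightarrow> real" where
  "pot_avg N Y b = cell_avg N (\<lambda>i g t. Y i g t b)"

definition cell_ate ::
    "(nat \<Rightarrow> nat \<Rightarrow> nat) \<Rightarrow> (nat \<Rightarrow> nat \<Rightarrow> nat \<Rightarrow> bool \<Rightarrow> 'a \<Rightarrow> real) \<Rightarrow> nat \<Rightarrow> nat \<Rightarrow> 'a \<Rightarrow> real" where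
  "cell_ate N Y = cell_avg N (\<lambda>i g t \<omega>. Y i g t True \<omega> - Y i g t False \<omega>)"

definition treated_cells :: "nat \<Rightarrow> nat \<Rightarrow> (nat \<Rightarrow> nat \<Rightarrow> real) \<Rightarrow> (nat \<times> nat) set" where
  "treated_cells G T d = {(g, t). g \<in> {1..G} \<and> t \<in> {1..T} \<and> d g t = 1}"

text \<open>The number of treated observations, as a function of the cell averages of the treatment.\<close>

definition num_treated ::
    "(nat \<Rightarrow> nat \<Rightarrow> nat) \<Rightarrow> nat \<Rightarrow> nat \<Rightarrow> (nat \<Rightarrow> nat \<Rightarrow> real) \<Rightarrow> real" where
  "num_treated N G T d = (\<Sum>g = 1..G. \<Sum>t = 1..T. real (N g t) * d g t)"

lemma num_treated_treat_avg:
  "num_treated N G T (\<lambda>g t. treat_avg N D g t \<omega>) =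
     (\<Sum>g = 1..G. \<Sum>t = 1..T. \<Sum>i = 1..N g t. of_bool (D i g t \<omega>))"
  unfolding num_treated_def treat_avg_def cell_avg_def
  by (intro sum.cong refl) simp

definition att ::
    "(nat \<Rightarrow> nat \<Rightarrow> nat) \<Rightarrow> nat \<Rightarrow> nat \<Rightarrow> (nat \<Rightarrow> nat \<Rightarrow> nat \<Rightarrow> 'a \<Rightarrow> bool) \<Rightarrow>
     (nat \<Rightarrow> nat \<Rightarrow> nat \<Rightarrow> bool \<Rightarrow> 'a \<Rightarrow> real) \<Rightarrow> 'a \<Rightarrow> real" where
  "att N G T D Y \<omega> =
     (\<Sum>(g, t) \<in> treated_cells G T (\<lambda>g t. treat_avg N D g t \<omega>).
        \<Sum>i = 1..N g t. Y i g t True \<omega> - Y i g t False \<omega>)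
     / num_treated N G T (\<lambda>g t. treat_avg N D g t \<omega>)"

text \<open>Least squares with group effects \<open>a\<close> and period effects \<open>c\<close>, over all observations.\<close>

definition fe_collinear :: "nat \<Rightarrow> nat \<Rightarrow> (nat \<Rightarrow> nat \<Rightarrow> real) \<Rightarrow> bool" where
  "fe_collinear G T d \<longleftrightarrow> (\<exists>a c. \<forall>g\<in>{1..G}. \<forall>t\<in>{1..T}. d g t = a g + c t)"

definition fe_ssr ::
    "(nat \<Rightarrow> nat \<Rightarrow> nat) \<Rightarrow> nat \<Rightarrow> nat \<Rightarrow> (nat \<Rightarrow> nat \<Rightarrow> nat \<Rightarrow> real) \<Rightarrow> (nat \<Rightarrow> nat \<Rightarrow> real) \<Rightarrow>
     (nat \<Rightarrow> real) \<Rightarrow> (nat \<Rightarrow> real) \<Rightarrow> real \<Rightarrow> real" where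
  "fe_ssr N G T y d a c b =
     (\<Sum>g = 1..G. \<Sum>t = 1..T. \<Sum>i = 1..N g t. (y i g t - a g - c t - b * d g t)\<^sup>2)"

text \<open>
  The minimizing effects are never unique (shift \<open>a\<close> up and \<open>c\<close> down), but the coefficient of \<open>d\<close>
  is, if \<open>d\<close> is not collinear with the effects and all cells are nonempty.
\<close>

definition beta_fe ::
    "(nat \<Rightarrow> nat \<Rightarrow> nat) \<Rightarrow> nat \<Rightarrow> nat \<Rightarrow> (nat \<Rightarrow> nat \<Rightarrow> nat \<Rightarrow> real) \<Rightarrow> (nat \<Rightarrow> nat \<Rightarrow> real) \<Rightarrow> real" where
  "beta_fe N G T y d =
     (THE b. \<exists>a c. \<forall>a' c' b'. fe_ssr N G T y d a c b \<le> fe_ssr N G T y d a' c' b')"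

text \<open>The coefficient of the cell treatment when the outcome is the observed one.\<close>

definition beta_fe_hat ::
    "(nat \<Rightarrow> nat \<Rightarrow> nat) \<Rightarrow> nat \<Rightarrow> nat \<Rightarrow> (nat \<Rightarrow> nat \<Rightarrow> nat \<Rightarrow> 'a \<Rightarrow> bool) \<Rightarrow>
     (nat \<Rightarrow> nat \<Rightarrow> nat \<Rightarrow> bool \<Rightarrow> 'a \<Rightarrow> real) \<Rightarrow> 'a \<Rightarrow> real" where
  "beta_fe_hat N G T D Y \<omega> =
     beta_fe N G T (\<lambda>i g t. Y i g t (D i g t \<omega>) \<omega>) (\<lambda>g t. treat_avg N D g t \<omega>)"

definition fe_ssr0 ::
    "(nat \<Rightarrow> nat \<Rightarrow> nat) \<Rightarrow> nat \<Rightarrow> nat \<Rightarrow> (nat \<Rightarrow> nat \<Rightarrow> real) \<Rightarrow> (nat \<Rightarrow> real) \<Rightarrow> (nat \<Rightarrow> real) \<Rightarrow> real" where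
  "fe_ssr0 N G T d a c =
     (\<Sum>g = 1..G. \<Sum>t = 1..T. \<Sum>i = 1..N g t. (d g t - a g - c t)\<^sup>2)"

text \<open>The residual in the regression of \<open>d\<close> on the effects; again unique although the effects are not.\<close>

definition fe_resid ::
    "(nat \<Rightarrow> nat \<Rightarrow> nat) \<Rightarrow> nat \<Rightarrow> nat \<Rightarrow> (nat \<Rightarrow> nat \<Rightarrow> real) \<Rightarrow> nat \<Rightarrow> nat \<Rightarrow> real" where
  "fe_resid N G T d g t =
     (THE e. \<exists>a c. (\<forall>a' c'. fe_ssr0 N G T d a c \<le> fe_ssr0 N G T d a' c') \<and> e = d g t - a g - c t)"

definition treated_mean ::
    "(nat \<Rightarrow> nat \<Rightarrow> nat) \<Rightarrow> nat \<Rightarrow> nat \<Rightarrow> (nat \<Rightarrow> nat \<Rightarrow> real) \<Rightarrow> (nat \<Rightarrow> nat \<Rightarrow> real) \<Rightarrow> real" where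
  "treated_mean N G T d x =
     (\<Sum>(g, t) \<in> treated_cells G T d. real (N g t) / num_treated N G T d * x g t)"

definition treated_sd ::
    "(nat \<Rightarrow> nat \<Rightarrow> nat) \<Rightarrow> nat \<Rightarrow> nat \<Rightarrow> (nat \<Rightarrow> nat \<Rightarrow> real) \<Rightarrow> (nat \<Rightarrow> nat \<Rightarrow> real) \<Rightarrow> real" where
  "treated_sd N G T d x =
     sqrt (\<Sum>(g, t) \<in> treated_cells G T d.
       real (N g t) / num_treated N G T d * (x g t - treated_mean N G T d x)\<^sup>2)"

definition fe_weight ::
    "(nat \<Rightarrow> nat \<Rightarrow> nat) \<Rightarrow> nat \<Rightarrow> nat \<Rightarrow> (nat \<Rightarrow> nat \<Rightarrow> real) \<Rightarrow> nat \<Rightarrow> nat \<Rightarrow> real" where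
  "fe_weight N G T d g t =
     fe_resid N G T d g t /
     (\<Sum>(g', t') \<in> treated_cells G T d.
       real (N g' t') / num_treated N G T d * fe_resid N G T d g' t')"

text \<open>The event that the array of treatment averages takes the value \<open>d\<close>.\<close>

definition treat_event ::
    "'a measure \<Rightarrow> (nat \<Rightarrow> nat \<Rightarrow> nat) \<Rightarrow> nat \<Rightarrow> nat \<Rightarrow> (nat \<Rightarrow> nat \<Rightarrow> nat \<Rightarrow> 'a \<Rightarrow> bool) \<Rightarrow>
     (nat \<Rightarrow> nat \<Rightarrow> real) \<Rightarrow> 'a set" where
  "treat_event M N G T D d =
     {\<omega> \<in> space M. \<forall>g\<in>{1..G}. \<forall>t\<in>{1..T}. treat_avg N D g t \<omega> = d g t}"

text \<open>The expectation of \<open>X\<close> given an event of positive probability.\<close>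

definition cond_mean :: "'a measure \<Rightarrow> 'a set \<Rightarrow> ('a \<Rightarrow> real) \<Rightarrow> real" where
  "cond_mean M A X = (LINT \<omega>:A|M. X \<omega>) / measure M A"

text \<open>The sigma-algebra generated by the treatment path of group \<open>g\<close>.\<close>

definition group_treat_algebra ::
    "'a measure \<Rightarrow> (nat \<Rightarrow> nat \<Rightarrow> nat) \<Rightarrow> nat \<Rightarrow> (nat \<Rightarrow> nat \<Rightarrow> nat \<Rightarrow> 'a \<Rightarrow> bool) \<Rightarrow> nat \<Rightarrow> 'a measure" where
  "group_treat_algebra M N T D g =
     vimage_algebra (space M) (\<lambda>\<omega>. \<lambda>t\<in>{1..T}. treat_avg N D g t \<omega>) (PiM {1..T} (\<lambda>_. borel))"

definition different_sign :: "real \<Rightarrow> real \<Rightarrow> bool" where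
  "different_sign x b \<longleftrightarrow> (b > 0 \<longrightarrow> x \<le> 0) \<and> (b < 0 \<longrightarrow> x \<ge> 0)"

text \<open>
  An enumeration \<open>p 1, \<dots>, p n\<close> of the treated cells along which \<open>w\<close> decreases;
  it is not unique if \<open>w\<close> has ties.
\<close>

definition decreasing_enum ::
    "nat \<Rightarrow> nat \<Rightarrow> (nat \<Rightarrow> nat \<Rightarrow> real) \<Rightarrow> (nat \<Rightarrow> nat \<Rightarrow> real) \<Rightarrow> (nat \<Rightarrow> nat \<times> nat) \<Rightarrow> bool" where
  "decreasing_enum G T d w p \<longleftrightarrow>
     bij_betw p {1..card (treated_cells G T d)} (treated_cells G T d) \<and>
     (\<forall>i j. 1 \<le> i \<and> i \<le> j \<and> j \<le> card (treated_cells G T d) \<longrightarrow>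
        case_prod w (p j) \<le> case_prod w (p i))"

text \<open>
  The sums \<open>P k\<close>, \<open>S k\<close> and \<open>T k\<close> over the ordered cells from the \<open>k\<close>-th on are obtained
  with \<open>f\<close> the constant 1, the weight and its square.
\<close>

definition tail_sum ::
    "(nat \<Rightarrow> nat \<Rightarrow> nat) \<Rightarrow> nat \<Rightarrow> nat \<Rightarrow> (nat \<Rightarrow> nat \<Rightarrow> real) \<Rightarrow> (nat \<Rightarrow> nat \<times> nat) \<Rightarrow>
     (nat \<Rightarrow> nat \<Rightarrow> real) \<Rightarrow> nat \<Rightarrow> real" where
  "tail_sum N G T d p f k =
     (\<Sum>i = k..card (treated_cells G T d).
       real (case_prod N (p i)) / num_treated N G T d * case_prod f (p i))"

text \<open>
  Since \<open>P 1 = S 1 = 1\<close>, the bound for \<open>i = 1\<close> is minus infinity; this index is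
  excluded explicitly because division by zero would give 0 here.
\<close>

definition cutoff_index ::
    "(nat \<Rightarrow> nat \<Rightarrow> nat) \<Rightarrow> nat \<Rightarrow> nat \<Rightarrow> (nat \<Rightarrow> nat \<Rightarrow> real) \<Rightarrow> (nat \<Rightarrow> nat \<times> nat) \<Rightarrow>
     (nat \<Rightarrow> nat \<Rightarrow> real) \<Rightarrow> nat" where
  "cutoff_index N G T d p w =
     (LEAST i. i \<in> {1..card (treated_cells G T d)} \<and> i \<noteq> 1 \<and>
        case_prod w (p i)
          < - tail_sum N G T d p w i / (1 - tail_sum N G T d p (\<lambda>_ _. 1) i))"

definition sigma_lower2 ::
    "(nat \<Rightarrow> nat \<Rightarrow> nat) \<Rightarrow> nat \<Rightarrow> nat \<Rightarrow> (nat \<Rightarrow> nat \<Rightarrow> real) \<Rightarrow> (nat \<Rightarrow> nat \<times> nat) \<Rightarrow>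
     (nat \<Rightarrow> nat \<Rightarrow> real) \<Rightarrow> real \<Rightarrow> real" where
  "sigma_lower2 N G T d p w b =
     (let s = cutoff_index N G T d p w;
          P_s = tail_sum N G T d p (\<lambda>_ _. 1) s;
          S_s = tail_sum N G T d p w s;
          T_s = tail_sum N G T d p (\<lambda>g t. (w g t)\<^sup>2) s
      in \<bar>b\<bar> / sqrt (T_s + S_s\<^sup>2 / (1 - P_s)))"

end

theory Submission
  imports Defs
begin

text \<open>
  By the Frisch--Waugh--Lovell theorem the regression coefficient is a linear combination of the
  cell outcomes with coefficients proportional to the residuals. Given the treatments, the
  untreated outcomes have additive expectations under independence, exogeneity and common trends,
  so the residuals annihilate them and the conditional mean of the coefficient is the treated mean
  of \<open>w g t * \<Delta> g t\<close>. What remains are two quadratic problems: the first is Cauchy--Schwarz, the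
  second has a minimizer supported on the cells of smallest weight.
\<close>

subsection \<open>Least squares with group and period effects\<close>

text \<open>Two obstacles shape the probabilistic half. Strong exogeneity conditions a group's trend
  on its own treatment path, while the event fixes the treatments of all groups; independence
  bridges this, because integrals over the joint event factor across groups. Moreover, sharpness and
  non-collinearity hold almost surely, whereas everything is evaluated at one realization; since the
  event has positive probability, it contains sample points where they hold, and that settles them
  for \<open>d\<close>. In the second quadratic problem the mean m of the effects is free and must
  be found together with them. Up to sign, stationarity on the support reads \<open>y i\<close> - m
  = \<open>- \<mu> * w i\<close>. Writing m = \<open>\<mu> * \<theta>\<close> and summing over the
  support from index \<open>s\<close> gives \<open>\<theta> = \<theta> * P - S\<close>, so
  \<open>\<theta> = - S / (1 - P)\<close>, which is the threshold in the cutoff rule. The constraint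
  then reads \<open>\<mu> * (T - \<theta> * S) = b\<close>, and the bracket is
  \<open>T + S\<^sup>2 / (1 - P)\<close>.\<close>

lemma weighted_projection_exists:
  fixes W :: "'i \<Rightarrow> real" and v :: "'j \<Rightarrow> 'i \<Rightarrow> real" and y :: "'i \<Rightarrow> real"
  assumes "finite J" "finite I" and W: "\<And>i. i \<in> I \<Longrightarrow> W i > 0"
  shows "\<exists>k. \<forall>j\<in>J. (\<Sum>i\<in>I. W i * (y i - (\<Sum>l\<in>J. k l * v l i)) * v j i) = 0"
  using assms(1)
proof (induction J arbitrary: y rule: finite_induct)
  case empty
  then show ?case by simp
next
  case (insert m J)
  \<comment> \<open>One step of Gram-Schmidt: \<open>r\<close> and \<open>u\<close> are the
    residuals of \<open>y\<close> and of the new regressor against the old ones, and the fit is then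
    corrected along \<open>u\<close>. Linear dependence is allowed, as group and period dummies are
    dependent.\<close>
  obtain k where k: "\<And>j. j \<in> J \<Longrightarrow> (\<Sum>i\<in>I. W i * (y i - (\<Sum>l\<in>J. k l * v l i)) * v j i) = 0"
    using insert.IH[of y] by blast
  obtain h where h: "\<And>j. j \<in> J \<Longrightarrow> (\<Sum>i\<in>I. W i * (v m i - (\<Sum>l\<in>J. h l * v l i)) * v j i) = 0"
    using insert.IH[of "v m"] by blast
  define r where "r = (\<lambda>i. y i - (\<Sum>l\<in>J. k l * v l i))"
  define u where "u = (\<lambda>i. v m i - (\<Sum>l\<in>J. h l * v l i))"
  \<comment> \<open>If \<open>u\<close> vanishes on \<open>I\<close> this is 0 / 0 = 0, and
    orthogonality to \<open>u\<close> is then trivial.\<close>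
  define b where "b = (\<Sum>i\<in>I. W i * r i * u i) / (\<Sum>i\<in>I. W i * (u i)\<^sup>2)"
  \<comment> \<open>The correction \<open>b * u\<close> rewritten in the original regressors:
    \<open>u\<close> is \<open>v m\<close> minus its own fit.\<close>
  define k' where "k' = (\<lambda>l. if l = m then b else k l - b * h l)"
  have res: "y i - (\<Sum>l\<in>insert m J. k' l * v l i) = r i - b * u i" for i
  proof -
    have "(\<Sum>l\<in>J. k' l * v l i) = (\<Sum>l\<in>J. k l * v l i - b * (h l * v l i))"
      using insert.hyps by (intro sum.cong) (auto simp: k'_def algebra_simps)
    then show ?thesis
      using insert.hyps
      by (simp add: r_def u_def sum_subtractf sum_distrib_left[symmetric] algebra_simps k'_def)
  qed
  have orthJ: "(\<Sum>i\<in>I. W i * (r i - b * u i) * v j i) = 0" if "j \<in> J" for j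
  proof -
    have "(\<Sum>i\<in>I. W i * (r i - b * u i) * v j i)
        = (\<Sum>i\<in>I. W i * r i * v j i) - b * (\<Sum>i\<in>I. W i * u i * v j i)"
      by (simp add: sum_subtractf sum_distrib_left algebra_simps)
    then show ?thesis using k[OF that] h[OF that] by (simp add: r_def u_def)
  qed
  have orthu: "(\<Sum>i\<in>I. W i * (r i - b * u i) * u i) = 0"
  proof -
    have *: "(\<Sum>i\<in>I. W i * (r i - b * u i) * u i)
        = (\<Sum>i\<in>I. W i * r i * u i) - b * (\<Sum>i\<in>I. W i * (u i)\<^sup>2)"
      by (simp add: sum_subtractf sum_distrib_left algebra_simps power2_eq_square)
    show ?thesis
    proof (cases "(\<Sum>i\<in>I. W i * (u i)\<^sup>2) = 0")
      case True
      moreover have "W i * (u i)\<^sup>2 \<ge> 0" if "i \<in> I" for i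
        using W[OF that] by simp
      ultimately have "\<forall>i\<in>I. W i * (u i)\<^sup>2 = 0"
        using sum_nonneg_eq_0_iff[OF \<open>finite I\<close>, of "\<lambda>i. W i * (u i)\<^sup>2"] by blast
      then have "\<And>i. i \<in> I \<Longrightarrow> u i = 0"
        using W by fastforce
      then show ?thesis by simp
    next
      case False
      then show ?thesis unfolding * by (simp add: b_def)
    qed
  qed
  \<comment> \<open>\<open>v m\<close> is \<open>u\<close> plus a combination of old regressors, and
    the new residual is orthogonal to both.\<close>
  have orthm: "(\<Sum>i\<in>I. W i * (r i - b * u i) * v m i) = 0"
  proof -
    have "(\<Sum>i\<in>I. W i * (r i - b * u i) * v m i)
       = (\<Sum>i\<in>I. W i * (r i - b * u i) * u i) +
         (\<Sum>i\<in>I. \<Sum>l\<in>J. h l * (W i * (r i - b * u i) * v l i))"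
      unfolding sum.distrib[symmetric]
    proof (intro sum.cong refl)
      fix i
      have vm: "v m i = u i + (\<Sum>l\<in>J. h l * v l i)" by (simp add: u_def)
      show "W i * (r i - b * u i) * v m i
        = W i * (r i - b * u i) * u i + (\<Sum>l\<in>J. h l * (W i * (r i - b * u i) * v l i))"
        unfolding vm distrib_left sum_distrib_left by (simp add: mult_ac)
    qed
    also have "(\<Sum>i\<in>I. \<Sum>l\<in>J. h l * (W i * (r i - b * u i) * v l i))
       = (\<Sum>l\<in>J. h l * (\<Sum>i\<in>I. W i * (r i - b * u i) * v l i))"
      by (subst sum.swap) (simp add: sum_distrib_left)
    finally show ?thesis using orthJ orthu by simp
  qed
  show ?case
    by (rule exI[of _ k']) (use orthJ orthm in \<open>auto simp: res\<close>)
qed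

text \<open>The normal equations for the group and period dummies, stated for a residual alone, so
  that no choice of the non-unique effects enters.\<close>

definition fe_orthogonal ::
    "(nat \<Rightarrow> nat \<Rightarrow> nat) \<Rightarrow> nat \<Rightarrow> nat \<Rightarrow> (nat \<Rightarrow> nat \<Rightarrow> real) \<Rightarrow> bool" where
  "fe_orthogonal N G T e \<longleftrightarrow>
     (\<forall>g\<in>{1..G}. (\<Sum>t = 1..T. real (N g t) * e g t) = 0) \<and>
     (\<forall>t\<in>{1..T}. (\<Sum>g = 1..G. real (N g t) * e g t) = 0)"

lemma fe_orthogonal_sum:
  assumes "fe_orthogonal N G T e"
  shows "(\<Sum>g = 1..G. \<Sum>t = 1..T. real (N g t) * e g t * (a g + c t)) = 0"
proof -
  have "(\<Sum>g = 1..G. \<Sum>t = 1..T. real (N g t) * e g t * (a g + c t))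
     = (\<Sum>g = 1..G. a g * (\<Sum>t = 1..T. real (N g t) * e g t))
       + (\<Sum>g = 1..G. \<Sum>t = 1..T. c t * (real (N g t) * e g t))"
    by (simp add: sum.distrib[symmetric] sum_distrib_left algebra_simps)
  also have "(\<Sum>g = 1..G. \<Sum>t = 1..T. c t * (real (N g t) * e g t))
     = (\<Sum>t = 1..T. c t * (\<Sum>g = 1..G. real (N g t) * e g t))"
    by (subst sum.swap) (simp add: sum_distrib_left)
  finally show ?thesis using assms by (simp add: fe_orthogonal_def)
qed

lemma fe_projection_exists:
  assumes N: "\<And>g t. g \<in> {1..G} \<Longrightarrow> t \<in> {1..T} \<Longrightarrow> N g t > 0"
  shows "\<exists>a c. fe_orthogonal N G T (\<lambda>g t. y g t - a g - c t)"
proof -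
  \<comment> \<open>Group dummies are indexed by \<open>Inl\<close>, period dummies by
    \<open>Inr\<close>; in each cell exactly one of either kind is 1.\<close>
  define v :: "nat + nat \<Rightarrow> nat \<times> nat \<Rightarrow> real"
    where "v = (\<lambda>j (g, t). case j of Inl g' \<Rightarrow> of_bool (g' = g) | Inr t' \<Rightarrow> of_bool (t' = t))"
  obtain k where k: "\<And>j. j \<in> {1..G} <+> {1..T} \<Longrightarrow>
     (\<Sum>i\<in>{1..G} \<times> {1..T}. real (case_prod N i) *
       (case_prod y i - (\<Sum>l\<in>{1..G} <+> {1..T}. k l * v l i)) * v j i) = 0"
    using weighted_projection_exists[of "{1..G} <+> {1..T}" "{1..G} \<times> {1..T}"
        "\<lambda>i. real (case_prod N i)" "case_prod y" v] N by force
  define a c where "a = (\<lambda>g. k (Inl g))" and "c = (\<lambda>t. k (Inr t))"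
  have fit: "(\<Sum>l\<in>{1..G} <+> {1..T}. k l * v l (g, t)) = a g + c t"
    if "g \<in> {1..G}" "t \<in> {1..T}" for g t
    using that by (simp add: sum.Plus v_def a_def c_def)
  have orth: "(\<Sum>g = 1..G. \<Sum>t = 1..T. real (N g t) * (y g t - a g - c t) * v j (g, t)) = 0"
    if "j \<in> {1..G} <+> {1..T}" for j
  proof -
    have "(\<Sum>g = 1..G. \<Sum>t = 1..T. real (N g t) * (y g t - a g - c t) * v j (g, t))
      = (\<Sum>i\<in>{1..G} \<times> {1..T}. real (case_prod N i) *
       (case_prod y i - (\<Sum>l\<in>{1..G} <+> {1..T}. k l * v l i)) * v j i)"
      unfolding sum.cartesian_product
      by (intro sum.cong refl) (clarsimp simp: fit simp del: atLeastAtMost_iff One_nat_def)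
    with k[OF that] show ?thesis by simp
  qed
  have "(\<Sum>t = 1..T. real (N g t) * (y g t - a g - c t)) = 0" if g: "g \<in> {1..G}" for g
  proof -
    have "(\<Sum>g' = 1..G. \<Sum>t = 1..T. real (N g' t) * (y g' t - a g' - c t) * v (Inl g) (g', t))
      = (\<Sum>g' = 1..G. if g = g' then (\<Sum>t = 1..T. real (N g' t) * (y g' t - a g' - c t)) else 0)"
      by (intro sum.cong refl) (auto simp: v_def)
    with orth[of "Inl g"] g show ?thesis by (simp add: InlI)
  qed
  moreover have "(\<Sum>g = 1..G. real (N g t) * (y g t - a g - c t)) = 0" if t: "t \<in> {1..T}" for t
  proof -
    have "(\<Sum>g = 1..G. \<Sum>t' = 1..T. real (N g t') * (y g t' - a g - c t') * v (Inr t) (g, t'))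
      = (\<Sum>g = 1..G. \<Sum>t' = 1..T. if t = t' then real (N g t') * (y g t' - a g - c t') else 0)"
      by (intro sum.cong refl) (auto simp: v_def)
    with orth[of "Inr t"] t show ?thesis by (simp add: InrI)
  qed
  ultimately show ?thesis unfolding fe_orthogonal_def by blast
qed

lemma weighted_sum_squares_eq_0:
  fixes N :: "nat \<Rightarrow> nat \<Rightarrow> nat" and f :: "nat \<Rightarrow> nat \<Rightarrow> real"
  assumes "\<And>g t. g \<in> {1..G} \<Longrightarrow> t \<in> {1..T} \<Longrightarrow> N g t > 0"
    and "(\<Sum>g = 1..G. \<Sum>t = 1..T. real (N g t) * (f g t)\<^sup>2) \<le> 0"
    and "g \<in> {1..G}" "t \<in> {1..T}"
  shows "f g t = 0"
proof -
  have "(\<Sum>(g, t)\<in>{1..G} \<times> {1..T}. real (N g t) * (f g t)\<^sup>2) = 0"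
    using assms(2) by (intro antisym) (auto simp: sum.cartesian_product intro!: sum_nonneg)
  then have "real (N g t) * (f g t)\<^sup>2 = 0"
    using assms(3,4) by (subst (asm) sum_nonneg_eq_0_iff) auto
  with assms(1)[OF assms(3,4)] show ?thesis by simp
qed

text \<open>Pythagoras: the cross term pairs the residual with a sum of a group and a period effect,
  to which it is orthogonal.\<close>

lemma fe_ssr0_decomp:
  assumes "fe_orthogonal N G T (\<lambda>g t. d g t - a g - c t)"
  shows "fe_ssr0 N G T d a' c' = fe_ssr0 N G T d a c +
     (\<Sum>g = 1..G. \<Sum>t = 1..T. real (N g t) * (a' g - a g + (c' t - c t))\<^sup>2)"
proof -
  have "fe_ssr0 N G T d a' c' = fe_ssr0 N G T d a c +
     (\<Sum>g = 1..G. \<Sum>t = 1..T. real (N g t) * (a' g - a g + (c' t - c t))\<^sup>2)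
     - 2 * (\<Sum>g = 1..G. \<Sum>t = 1..T.
         real (N g t) * (d g t - a g - c t) * ((a' g - a g) + (c' t - c t)))"
    unfolding fe_ssr0_def sum_distrib_left sum.distrib[symmetric] sum_subtractf[symmetric]
    by (intro sum.cong refl) (simp add: power2_eq_square algebra_simps)
  then show ?thesis
    using fe_orthogonal_sum[OF assms, of "\<lambda>g. a' g - a g" "\<lambda>t. c' t - c t"] by simp
qed

text \<open>This justifies the definite description: the excess of another minimizer is a weighted
  sum of squares that must vanish, so with nonempty cells the fitted value agrees in every cell even
  where the two effects differ.\<close>

lemma fe_resid_eq:
  assumes N: "\<And>g t. g \<in> {1..G} \<Longrightarrow> t \<in> {1..T} \<Longrightarrow> N g t > 0"
    and orth: "fe_orthogonal N G T (\<lambda>g t. d g t - a g - c t)"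
    and gt: "g \<in> {1..G}" "t \<in> {1..T}"
  shows "fe_resid N G T d g t = d g t - a g - c t"
  unfolding fe_resid_def
proof (rule the_equality)
  show "\<exists>a' c'. (\<forall>a'' c''. fe_ssr0 N G T d a' c' \<le> fe_ssr0 N G T d a'' c'') \<and>
      d g t - a g - c t = d g t - a' g - c' t"
  proof (rule exI[of _ a], rule exI[of _ c], intro conjI allI refl)
    fix a' c'
    have "0 \<le> (\<Sum>g = 1..G. \<Sum>t = 1..T. real (N g t) * (a' g - a g + (c' t - c t))\<^sup>2)"
      by (intro sum_nonneg) simp
    then show "fe_ssr0 N G T d a c \<le> fe_ssr0 N G T d a' c'"
      using fe_ssr0_decomp[OF orth, of a' c'] by linarith
  qed
next
  fix e
  assume "\<exists>a' c'. (\<forall>a'' c''. fe_ssr0 N G T d a' c' \<le> fe_ssr0 N G T d a'' c'') \<and>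
      e = d g t - a' g - c' t"
  then obtain a' c' where le: "fe_ssr0 N G T d a' c' \<le> fe_ssr0 N G T d a c"
    and e: "e = d g t - a' g - c' t" by blast
  have "a' g - a g + (c' t - c t) = 0"
    using weighted_sum_squares_eq_0[where f = "\<lambda>g t. a' g - a g + (c' t - c t)", OF N _ gt] le
    unfolding fe_ssr0_decomp[OF orth, of a' c'] by simp
  with e show "e = d g t - a g - c t" by simp
qed

lemma fe_resid_decomp:
  assumes N: "\<And>g t. g \<in> {1..G} \<Longrightarrow> t \<in> {1..T} \<Longrightarrow> N g t > 0"
  shows "fe_orthogonal N G T (fe_resid N G T d)"
    and "\<exists>a c. \<forall>g\<in>{1..G}. \<forall>t\<in>{1..T}. d g t = a g + c t + fe_resid N G T d g t"
proof -
  obtain a c where orth: "fe_orthogonal N G T (\<lambda>g t. d g t - a g - c t)"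
    using fe_projection_exists[of G T N d] N by blast
  note eq = fe_resid_eq[OF N orth]
  show "fe_orthogonal N G T (fe_resid N G T d)"
    using orth
    by (simp add: fe_orthogonal_def eq cong: sum.cong del: One_nat_def atLeastAtMost_iff)
  show "\<exists>a c. \<forall>g\<in>{1..G}. \<forall>t\<in>{1..T}. d g t = a g + c t + fe_resid N G T d g t"
    by (rule exI[of _ a], rule exI[of _ c]) (simp add: eq del: One_nat_def atLeastAtMost_iff)
qed

text \<open>\<open>d\<close> and its residual differ by additive effects, which \<open>e\<close>
  does not see. Taking the residual of \<open>d\<close> for \<open>e\<close> yields a sum of
  squares; taking the residual of an outcome yields the normal equation for
  \<open>d\<close>.\<close>

lemma fe_resid_inner:
  assumes N: "\<And>g t. g \<in> {1..G} \<Longrightarrow> t \<in> {1..T} \<Longrightarrow> N g t > 0"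
    and e: "fe_orthogonal N G T e"
  shows "(\<Sum>g = 1..G. \<Sum>t = 1..T. real (N g t) * e g t * d g t)
    = (\<Sum>g = 1..G. \<Sum>t = 1..T. real (N g t) * e g t * fe_resid N G T d g t)"
proof -
  obtain a c where d: "\<And>g t. g \<in> {1..G} \<Longrightarrow> t \<in> {1..T} \<Longrightarrow>
      d g t = a g + c t + fe_resid N G T d g t"
    using fe_resid_decomp(2)[of G T N d] N by blast
  have "(\<Sum>g = 1..G. \<Sum>t = 1..T. real (N g t) * e g t * d g t)
      = (\<Sum>g = 1..G. \<Sum>t = 1..T. real (N g t) * e g t * (a g + c t) +
          real (N g t) * e g t * fe_resid N G T d g t)"
  proof (intro sum.cong refl)
    fix g t assume "g \<in> {1..G}" "t \<in> {1..T}"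
    then show "real (N g t) * e g t * d g t = real (N g t) * e g t * (a g + c t) +
          real (N g t) * e g t * fe_resid N G T d g t"
      by (subst d) (simp_all add: algebra_simps)
  qed
  then show ?thesis
    using fe_orthogonal_sum[OF e, of a c] by (simp add: sum.distrib)
qed

text \<open>The sum equals the weighted sum of squared residuals, which vanishes only if
  \<open>d\<close> is itself a sum of effects. It is the denominator of the coefficient and, up to a
  factor, of the weights.\<close>

lemma fe_resid_inner_pos:
  assumes N: "\<And>g t. g \<in> {1..G} \<Longrightarrow> t \<in> {1..T} \<Longrightarrow> N g t > 0"
    and nc: "\<not> fe_collinear G T d"
  shows "(\<Sum>g = 1..G. \<Sum>t = 1..T. real (N g t) * fe_resid N G T d g t * d g t) > 0"
proof (rule ccontr)
  assume "\<not> ?thesis"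
  then have "(\<Sum>g = 1..G. \<Sum>t = 1..T. real (N g t) * (fe_resid N G T d g t)\<^sup>2) \<le> 0"
    using fe_resid_inner[OF N fe_resid_decomp(1)[OF N], where d = d]
    by (simp add: power2_eq_square mult.assoc)
  from weighted_sum_squares_eq_0[OF N this]
  have "\<And>g t. g \<in> {1..G} \<Longrightarrow> t \<in> {1..T} \<Longrightarrow> fe_resid N G T d g t = 0" .
  then show False
    using fe_resid_decomp(2)[of G T N d] N nc unfolding fe_collinear_def by force
qed

text \<open>The coefficient is guessed and verified. Subtracting \<open>b * d\<close> from the cell
  means and projecting off the effects leaves a residual \<open>r\<close> that satisfies all normal
  equations for this \<open>b\<close>. Pythagoras makes it a minimizer, and a minimizer with another
  coefficient would exhibit \<open>d\<close> as a sum of effects.\<close>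

lemma beta_fe_eq:
  assumes N: "\<And>g t. g \<in> {1..G} \<Longrightarrow> t \<in> {1..T} \<Longrightarrow> N g t > 0"
    and nc: "\<not> fe_collinear G T d"
  shows "beta_fe N G T y d =
    (\<Sum>g = 1..G. \<Sum>t = 1..T. fe_resid N G T d g t * (\<Sum>i = 1..N g t. y i g t)) /
    (\<Sum>g = 1..G. \<Sum>t = 1..T. real (N g t) * fe_resid N G T d g t * d g t)"
    (is "_ = ?num / ?Q")
proof -
  define b where "b = ?num / ?Q"
  have Q: "?Q > 0" by (rule fe_resid_inner_pos[OF N nc])
  define z where "z = (\<lambda>g t. (\<Sum>i = 1..N g t. y i g t) / real (N g t) - b * d g t)"
  have Nz: "real (N g t) * z g t = (\<Sum>i = 1..N g t. y i g t) - b * real (N g t) * d g t"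
    if "g \<in> {1..G}" "t \<in> {1..T}" for g t
    using N[OF that] by (simp add: z_def field_simps)
  obtain a c where orth: "fe_orthogonal N G T (\<lambda>g t. z g t - a g - c t)"
    using fe_projection_exists[of G T N z] N by blast
  define r where "r = (\<lambda>g t. z g t - a g - c t)"
  let ?e = "fe_resid N G T d"
  have orthr: "fe_orthogonal N G T r" using orth by (simp add: r_def)
  \<comment> \<open>Normal equation for \<open>d\<close>: paired with \<open>r\<close>,
    \<open>d\<close> may be replaced by its residual; paired with that residual, the effects
    contained in \<open>r\<close> drop out, leaving \<open>?num - b * ?Q\<close>.\<close>
  have "(\<Sum>g = 1..G. \<Sum>t = 1..T. real (N g t) * r g t * d g t)
      = (\<Sum>g = 1..G. \<Sum>t = 1..T. real (N g t) * r g t * ?e g t)"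
    by (rule fe_resid_inner[OF N orthr])
  also have "\<dots> = (\<Sum>g = 1..G. \<Sum>t = 1..T. ?e g t * (real (N g t) * z g t))
      - (\<Sum>g = 1..G. \<Sum>t = 1..T. real (N g t) * ?e g t * (a g + c t))"
    unfolding sum_subtractf[symmetric]
    by (intro sum.cong refl) (simp add: r_def algebra_simps)
  also have "(\<Sum>g = 1..G. \<Sum>t = 1..T. real (N g t) * ?e g t * (a g + c t)) = 0"
    by (rule fe_orthogonal_sum[OF fe_resid_decomp(1)[OF N]])
  also have "(\<Sum>g = 1..G. \<Sum>t = 1..T. ?e g t * (real (N g t) * z g t)) = ?num - b * ?Q"
    unfolding sum_subtractf[symmetric] sum_distrib_left
    by (intro sum.cong refl) (subst Nz, simp_all add: algebra_simps sum_distrib_left)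
  also have "\<dots> = 0" using Q by (simp add: b_def)
  finally have orthd: "(\<Sum>g = 1..G. \<Sum>t = 1..T. real (N g t) * r g t * d g t) = 0" by simp
  have decomp: "fe_ssr N G T y d a' c' b' = fe_ssr N G T y d a c b +
     (\<Sum>g = 1..G. \<Sum>t = 1..T. real (N g t) * (a' g - a g + (c' t - c t) + (b' - b) * d g t)\<^sup>2)"
    for a' c' b'
  proof -
    \<comment> \<open>The cross term involves the outcomes of a cell only through their sum, that
      is, through \<open>z g t\<close>; this reduces the observation-level criterion to cell-level
      sums.\<close>
    have cell: "(\<Sum>i = 1..N g t. (y i g t - a' g - c' t - b' * d g t)\<^sup>2)
       = (\<Sum>i = 1..N g t. (y i g t - a g - c t - b * d g t)\<^sup>2)
       + real (N g t) * (a' g - a g + (c' t - c t) + (b' - b) * d g t)\<^sup>2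
       - 2 * (real (N g t) * r g t * ((a' g - a g) + (c' t - c t)))
       - 2 * (b' - b) * (real (N g t) * r g t * d g t)"
      if "g \<in> {1..G}" "t \<in> {1..T}" for g t
    proof -
      define m where "m = a' g - a g + (c' t - c t) + (b' - b) * d g t"
      have "(y i g t - a' g - c' t - b' * d g t)\<^sup>2
          = (y i g t - a g - c t - b * d g t)\<^sup>2 + m\<^sup>2 - 2 * m * y i g t
            + 2 * m * (a g + c t + b * d g t)" for i
        by (simp add: m_def power2_eq_square algebra_simps)
      then have "(\<Sum>i = 1..N g t. (y i g t - a' g - c' t - b' * d g t)\<^sup>2)
          = (\<Sum>i = 1..N g t. (y i g t - a g - c t - b * d g t)\<^sup>2) + real (N g t) * m\<^sup>2
            - 2 * m * (\<Sum>i = 1..N g t. y i g t)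
            + real (N g t) * (2 * m * (a g + c t + b * d g t))"
        by (simp add: sum.distrib sum_subtractf sum_distrib_left)
      also have "(\<Sum>i = 1..N g t. y i g t) = real (N g t) * (r g t + a g + c t + b * d g t)"
        using Nz[OF that] by (simp add: r_def algebra_simps)
      finally show ?thesis
        by (simp add: algebra_simps m_def[symmetric]) (simp add: m_def algebra_simps)
    qed
    have "fe_ssr N G T y d a' c' b' = fe_ssr N G T y d a c b +
       (\<Sum>g = 1..G. \<Sum>t = 1..T. real (N g t) * (a' g - a g + (c' t - c t) + (b' - b) * d g t)\<^sup>2)
       - 2 * (\<Sum>g = 1..G. \<Sum>t = 1..T. real (N g t) * r g t * ((a' g - a g) + (c' t - c t)))
       - 2 * (b' - b) * (\<Sum>g = 1..G. \<Sum>t = 1..T. real (N g t) * r g t * d g t)"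
      unfolding fe_ssr_def sum_distrib_left sum.distrib[symmetric] sum_subtractf[symmetric]
      using cell by (intro sum.cong refl) auto
    then show ?thesis
      using fe_orthogonal_sum[OF orthr, of "\<lambda>g. a' g - a g" "\<lambda>t. c' t - c t"] orthd by simp
  qed
  show ?thesis
    unfolding beta_fe_def b_def[symmetric]
  proof (rule the_equality)
    show "\<exists>a c. \<forall>a' c' b'. fe_ssr N G T y d a c b \<le> fe_ssr N G T y d a' c' b'"
    proof (rule exI[of _ a], rule exI[of _ c], intro allI)
      fix a' c' b'
      have "0 \<le> (\<Sum>g = 1..G. \<Sum>t = 1..T.
          real (N g t) * (a' g - a g + (c' t - c t) + (b' - b) * d g t)\<^sup>2)"
        by (intro sum_nonneg) simp
      then show "fe_ssr N G T y d a c b \<le> fe_ssr N G T y d a' c' b'"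
        using decomp[of a' c' b'] by linarith
    qed
  next
    fix b' assume "\<exists>a' c'. \<forall>a'' c'' b''. fe_ssr N G T y d a' c' b' \<le> fe_ssr N G T y d a'' c'' b''"
    then obtain a' c' where "fe_ssr N G T y d a' c' b' \<le> fe_ssr N G T y d a c b" by blast
    then have 0: "a' g - a g + (c' t - c t) + (b' - b) * d g t = 0"
      if "g \<in> {1..G}" "t \<in> {1..T}" for g t
      using weighted_sum_squares_eq_0[OF N _ that,
          where f = "\<lambda>g t. a' g - a g + (c' t - c t) + (b' - b) * d g t"]
      unfolding decomp[of a' c' b'] by simp
    show "b' = b"
    proof (rule ccontr)
      assume ne: "b' \<noteq> b"
      have "d g t = (a g - a' g) / (b' - b) + (c t - c' t) / (b' - b)"
        if "g \<in> {1..G}" "t \<in> {1..T}" for g t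
        using 0[OF that] ne by (simp add: divide_simps) (simp add: algebra_simps)
      then have "fe_collinear G T d"
        unfolding fe_collinear_def
        by (rule_tac x = "\<lambda>g. (a g - a' g) / (b' - b)" in exI,
            rule_tac x = "\<lambda>t. (c t - c' t) / (b' - b)" in exI) blast
      with nc show False ..
    qed
  qed
qed

subsection \<open>Weighted standard deviations under linear constraints\<close>

lemma weighted_Cauchy_Schwarz:
  fixes q x y :: "'i \<Rightarrow> real"
  assumes "\<And>i. i \<in> I \<Longrightarrow> q i \<ge> 0"
  shows "\<bar>\<Sum>i\<in>I. q i * (x i * y i)\<bar> \<le> sqrt (\<Sum>i\<in>I. q i * (x i)\<^sup>2) * sqrt (\<Sum>i\<in>I. q i * (y i)\<^sup>2)"
proof -
  have "(\<Sum>i\<in>I. q i * (x i * y i)) = (\<Sum>i\<in>I. (sqrt (q i) * x i) * (sqrt (q i) * y i))"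
  proof (intro sum.cong refl)
    fix i assume "i \<in> I"
    then have "q i = sqrt (q i) * sqrt (q i)" using assms by simp
    then show "q i * (x i * y i) = (sqrt (q i) * x i) * (sqrt (q i) * y i)"
      by (metis mult.assoc mult.left_commute)
  qed
  moreover have "(\<Sum>i\<in>I. (sqrt (q i) * z i)\<^sup>2) = (\<Sum>i\<in>I. q i * (z i)\<^sup>2)" for z
    using assms by (intro sum.cong refl) (simp add: power_mult_distrib)
  ultimately have "(\<Sum>i\<in>I. q i * (x i * y i))\<^sup>2
      \<le> (\<Sum>i\<in>I. q i * (x i)\<^sup>2) * (\<Sum>i\<in>I. q i * (y i)\<^sup>2)"
    using Cauchy_Schwarz_ineq_sum[of "\<lambda>i. sqrt (q i) * x i" "\<lambda>i. sqrt (q i) * y i" I] by simp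
  then show ?thesis
    by (metis real_sqrt_abs real_sqrt_le_mono real_sqrt_mult)
qed

text \<open>The index set is arbitrary because these notions are applied both to the treated cells
  and to their positions in an enumeration. Normalization of \<open>q\<close> is left to the
  lemmas.\<close>

definition wmean :: "'i set \<Rightarrow> ('i \<Rightarrow> real) \<Rightarrow> ('i \<Rightarrow> real) \<Rightarrow> real" where
  "wmean I q x = (\<Sum>i\<in>I. q i * x i)"

definition wsd :: "'i set \<Rightarrow> ('i \<Rightarrow> real) \<Rightarrow> ('i \<Rightarrow> real) \<Rightarrow> real" where
  "wsd I q x = sqrt (\<Sum>i\<in>I. q i * (x i - wmean I q x)\<^sup>2)"

lemma wmean_linear:
  "wmean I q (\<lambda>i. x i + y i) = wmean I q x + wmean I q y"
  "wmean I q (\<lambda>i. x i - y i) = wmean I q x - wmean I q y"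
  "wmean I q (\<lambda>i. k * x i) = k * wmean I q x"
  by (simp_all add: wmean_def sum.distrib sum_subtractf sum_distrib_left algebra_simps)

lemma wsd_scale: "wsd I q (\<lambda>i. k * x i) = \<bar>k\<bar> * wsd I q x"
proof -
  have "(\<Sum>i\<in>I. q i * (k * x i - k * wmean I q x)\<^sup>2) = k\<^sup>2 * (\<Sum>i\<in>I. q i * (x i - wmean I q x)\<^sup>2)"
    by (simp add: sum_distrib_left power2_eq_square algebra_simps)
  then show ?thesis by (simp add: wsd_def wmean_linear real_sqrt_mult)
qed

lemma wmean_const: "sum q I = 1 \<Longrightarrow> wmean I q (\<lambda>_. k) = k"
  by (simp add: wmean_def sum_distrib_right[symmetric])

lemma wcov_eq:
  assumes "sum q I = 1"
  shows "wmean I q (\<lambda>i. (x i - wmean I q x) * (y i - wmean I q y))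
     = wmean I q (\<lambda>i. x i * y i) - wmean I q x * wmean I q y"
proof -
  define a b where "a = wmean I q x" and "b = wmean I q y"
  have "(\<lambda>i. (x i - a) * (y i - b)) = (\<lambda>i. x i * y i - a * y i - b * x i + a * b)"
    by (simp add: algebra_simps)
  then have "wmean I q (\<lambda>i. (x i - a) * (y i - b)) = wmean I q (\<lambda>i. x i * y i) - a * b - b * a + a * b"
    by (simp only: wmean_linear wmean_const[OF assms] a_def[symmetric] b_def[symmetric])
  then show ?thesis by (simp add: a_def b_def mult.commute)
qed

lemma wsd_power2:
  assumes "sum q I = 1" "\<And>i. i \<in> I \<Longrightarrow> q i \<ge> 0"
  shows "(wsd I q x)\<^sup>2 = wmean I q (\<lambda>i. (x i)\<^sup>2) - (wmean I q x)\<^sup>2"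
proof -
  have "(\<Sum>i\<in>I. q i * (x i - wmean I q x)\<^sup>2) \<ge> 0"
    using assms(2) by (intro sum_nonneg) simp
  then show ?thesis
    using wcov_eq[OF assms(1), of x x] by (simp add: wsd_def power2_eq_square wmean_def)
qed

lemma wcov_le:
  assumes "sum q I = 1" "\<And>i. i \<in> I \<Longrightarrow> q i \<ge> 0"
  shows "\<bar>wmean I q (\<lambda>i. x i * y i) - wmean I q x * wmean I q y\<bar> \<le> wsd I q x * wsd I q y"
  using weighted_Cauchy_Schwarz[of I q "\<lambda>i. x i - wmean I q x" "\<lambda>i. y i - wmean I q y"] assms
    wcov_eq[OF assms(1), of x y]
  by (simp add: wsd_def wmean_def)

text \<open>For \<open>x\<close> of mean zero the constrained quantity is the covariance of
  \<open>w\<close> and \<open>x\<close>, so Cauchy--Schwarz bounds it by the product of standard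
  deviations.\<close>

lemma min_sd_zero_mean:
  assumes q: "sum q I = 1" "\<And>i. i \<in> I \<Longrightarrow> q i \<ge> 0"
    and w: "wmean I q w = 1" and sd: "wsd I q w > 0"
  shows "wmean I q x = 0 \<Longrightarrow> \<bar>wmean I q (\<lambda>i. w i * x i)\<bar> / wsd I q w \<le> wsd I q x"
    and "\<exists>x. wmean I q (\<lambda>i. w i * x i) = b \<and> wmean I q x = 0 \<and> wsd I q x = \<bar>b\<bar> / wsd I q w"
proof -
  show "wmean I q x = 0 \<Longrightarrow> \<bar>wmean I q (\<lambda>i. w i * x i)\<bar> / wsd I q w \<le> wsd I q x"
    using wcov_le[of q I w x] q sd by (simp add: field_simps)
  \<comment> \<open>Equality in Cauchy--Schwarz needs \<open>x\<close> proportional to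
    \<open>w i - 1\<close>. The covariance is then the factor times the variance of
    \<open>w\<close>, and equating it to \<open>b\<close> fixes the factor.\<close>
  define k where "k = b / (wsd I q w)\<^sup>2"
  define x where "x = (\<lambda>i. k * (w i - 1))"
  have mx: "wmean I q x = 0"
    by (simp add: x_def wmean_linear wmean_const[OF q(1)] w)
  have "wmean I q (\<lambda>i. w i * x i) = k * (wmean I q (\<lambda>i. (w i)\<^sup>2) - wmean I q w)"
    unfolding wmean_linear(2,3)[symmetric]
    by (simp add: x_def power2_eq_square algebra_simps)
  also have "\<dots> = k * (wsd I q w)\<^sup>2"
    using wsd_power2[of q I w] q w by simp
  also have "\<dots> = b" using sd by (simp add: k_def)
  finally have wx: "wmean I q (\<lambda>i. w i * x i) = b" .
  have "wsd I q (\<lambda>i. w i - 1) = wsd I q w"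
    by (simp add: wsd_def wmean_linear wmean_const[OF q(1)])
  then have "wsd I q x = \<bar>k\<bar> * wsd I q w"
    by (simp add: x_def wsd_scale)
  also have "\<dots> = \<bar>b\<bar> / wsd I q w"
    using sd by (simp add: k_def abs_divide power2_eq_square)
  finally show "\<exists>x. wmean I q (\<lambda>i. w i * x i) = b \<and> wmean I q x = 0 \<and> wsd I q x = \<bar>b\<bar> / wsd I q w"
    using mx wx by blast
qed

text \<open>Moving the term \<open>q k * w k\<close> across shows that
  \<open>w k < - S k / (1 - P k)\<close> is equivalent to
  \<open>w k * (1 - P (Suc k)) < - S (Suc k)\<close>. Hence failure of the test at the index before
  \<open>s\<close> already compares that weight with the threshold at \<open>s\<close>, and
  monotonicity extends both comparisons to all indices.\<close>

lemma cutoff_properties: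
  fixes q w :: "nat \<Rightarrow> real" and n :: nat
  defines "P \<equiv> \<lambda>k. \<Sum>i = k..n. q i" and "S \<equiv> \<lambda>k. \<Sum>i = k..n. q i * w i"
  defines "s \<equiv> LEAST i. i \<in> {1..n} \<and> i \<noteq> 1 \<and> w i < - S i / (1 - P i)"
  assumes q: "\<And>i. i \<in> {1..n} \<Longrightarrow> q i > 0" and q1: "sum q {1..n} = 1"
    and w1: "wmean {1..n} q w = 1"
    and dec: "\<And>i j. 1 \<le> i \<Longrightarrow> i \<le> j \<Longrightarrow> j \<le> n \<Longrightarrow> w j \<le> w i"
    and neg: "\<exists>i\<in>{1..n}. w i < 0"
  shows "s \<in> {2..n}" and "P s < 1"
    and "\<And>i. i \<in> {s..n} \<Longrightarrow> w i < - S s / (1 - P s)"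
    and "\<And>i. i \<in> {1..<s} \<Longrightarrow> - S s / (1 - P s) \<le> w i"
proof -
  obtain j where j: "1 \<le> j" "j \<le> n" "w j < 0" using neg by auto
  then have n1: "n \<ge> 1" by simp
  have wn: "w n < 0" using dec[of j n] j by simp
  have P_Suc: "P k = q k + P (Suc k)" and S_Suc: "S k = q k * w k + S (Suc k)"
    if "k \<le> n" for k
    using that by (simp_all add: P_def S_def sum.atLeast_Suc_atMost)
  have P1: "P 1 = 1" and S1: "S 1 = 1"
    using q1 w1 by (simp_all add: P_def S_def wmean_def)
  have P_lt: "P k < 1" if "k \<in> {2..n}" for k
  proof -
    have "{1..n} = {1..<k} \<union> {k..n}" using that by auto
    then have "P 1 = sum q {1..<k} + P k"
      unfolding P_def by (metis atLeastLessThan_iff disjoint_iff finite_atLeastAtMost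
          finite_atLeastLessThan atLeastAtMost_iff leD sum.union_disjoint)
    moreover have "sum q {1..<k} > 0"
      using that by (intro sum_pos q) auto
    ultimately show ?thesis using P1 by simp
  qed
  have n2: "n \<ge> 2"
  proof (rule ccontr)
    assume "\<not> n \<ge> 2"
    with n1 have "n = 1" by simp
    with q1 w1 wn show False by (simp add: wmean_def)
  qed
  \<comment> \<open>At the last index the test reduces to \<open>w n < 0\<close>, so the set whose
    least element is \<open>s\<close> is nonempty.\<close>
  have "w n < - S n / (1 - P n)"
    using P_lt[of n] n2 wn by (simp add: P_def S_def field_simps)
  with n2 have ex: "n \<in> {1..n} \<and> n \<noteq> 1 \<and> w n < - S n / (1 - P n)" by simp
  have s: "s \<in> {1..n} \<and> s \<noteq> 1 \<and> w s < - S s / (1 - P s)"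
    
    using LeastI[of "\<lambda>i. i \<in> {1..n} \<and> i \<noteq> 1 \<and> w i < - S i / (1 - P i)", OF ex]
    unfolding s_def[symmetric] .
  then show s2: "s \<in> {2..n}" by auto
  then show Ps: "P s < 1" by (rule P_lt)
  show "w i < - S s / (1 - P s)" if "i \<in> {s..n}" for i
  proof -
    have "w i \<le> w s" using that s by (intro dec) auto
    with s show ?thesis by linarith
  qed
  show "- S s / (1 - P s) \<le> w i" if i: "i \<in> {1..<s}" for i
  proof -
    define k where "k = s - 1"
    have sk: "s = Suc k" and k: "k \<in> {1..n}" "k < s" "i \<le> k" using s2 i by (auto simp: k_def)
    have "- S (Suc k) \<le> w k * (1 - P (Suc k))"
    \<comment> \<open>Index 1 is excluded by convention rather than by a failed test, so the
      inequality is computed directly: the right side is \<open>1 - S (Suc 1)\<close>.\<close>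
    proof (cases "k = 1")
      case True
      have "1 - P (Suc 1) = q 1" and "q 1 * w 1 = 1 - S (Suc 1)"
        using P1 S1 P_Suc[OF n1] S_Suc[OF n1] by linarith+
      then have "w 1 * (1 - P (Suc 1)) = 1 - S (Suc 1)" by (simp add: mult.commute)
      with True show ?thesis by simp
    next
      case False
      with k have "k \<in> {2..n}" by auto
      then have "P k < 1" by (rule P_lt)
      moreover have "\<not> w k < - S k / (1 - P k)"
        using not_less_Least[of k "\<lambda>i. i \<in> {1..n} \<and> i \<noteq> 1 \<and> w i < - S i / (1 - P i)"] k False
        unfolding s_def[symmetric] by blast
      ultimately have "- S k \<le> w k * (1 - P k)"
        by (simp add: field_simps)
      then show ?thesis
        using P_Suc[of k] S_Suc[of k] k by (simp add: algebra_simps)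
    qed
    then have "- S s / (1 - P s) \<le> w k"
      using Ps by (simp add: sk field_simps)
    also have "w k \<le> w i" using k i by (intro dec) auto
    finally show ?thesis .
  qed
qed

text \<open>
  The minimizer is \<open>y i = \<mu> * max 0 (\<theta> - w i)\<close>, where the level \<open>\<theta>\<close> is such that the mean
  of \<open>y\<close> is \<open>\<mu> * \<theta>\<close>; these are the first-order conditions of the problem. A competitor \<open>x\<close> has
  covariance at least \<open>\<mu> * b\<close> with \<open>y\<close>, which is the variance of \<open>y\<close>.
\<close>

lemma min_sd_nonneg:
  fixes q w :: "nat \<Rightarrow> real" and n s :: nat
  defines "P \<equiv> \<Sum>i = s..n. q i" and "S \<equiv> \<Sum>i = s..n. q i * w i"
    and "T \<equiv> \<Sum>i = s..n. q i * (w i)\<^sup>2"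
  assumes q: "\<And>i. i \<in> {1..n} \<Longrightarrow> q i > 0" and q1: "sum q {1..n} = 1"
    and s: "s \<in> {1..n}" "P < 1"
    and above: "\<And>i. i \<in> {s..n} \<Longrightarrow> w i < - S / (1 - P)"
    and below: "\<And>i. i \<in> {1..<s} \<Longrightarrow> - S / (1 - P) \<le> w i"
    and b: "b > 0"
  shows "(\<And>i. i \<in> {1..n} \<Longrightarrow> x i \<ge> 0) \<Longrightarrow> wmean {1..n} q (\<lambda>i. w i * x i) = - b \<Longrightarrow>
      b / sqrt (T + S\<^sup>2 / (1 - P)) \<le> wsd {1..n} q x"
    and "\<exists>y. (\<forall>i. y i \<ge> 0) \<and> wmean {1..n} q (\<lambda>i. w i * y i) = - b \<and>
      wsd {1..n} q y = b / sqrt (T + S\<^sup>2 / (1 - P))"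
proof -
  let ?I = "{1..n}"
  have q0: "q i \<ge> 0" if "i \<in> ?I" for i using q[OF that] by simp
  define \<theta> where "\<theta> = - S / (1 - P)"
  define K where "K = T + S\<^sup>2 / (1 - P)"
  have K\<theta>: "K = T - \<theta> * S" by (simp add: K_def \<theta>_def power2_eq_square)
  \<comment> \<open>The fixed-point equation that makes \<open>\<mu> * \<theta>\<close> the mean of
    \<open>y\<close>.\<close>
  have \<theta>P: "\<theta> * P - S = \<theta>" using s(2) by (simp add: \<theta>_def field_simps)
  \<comment> \<open>Either the cell at \<open>s\<close> contributes to \<open>T\<close>, or its
    weight is 0 and the strict inequality \<open>above\<close> makes \<open>S\<close>
    nonzero.\<close>
  have K: "K > 0"
  proof (cases "w s = 0")
    case True
    with above[of s] s have "S \<noteq> 0" by auto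
    then have "S\<^sup>2 / (1 - P) > 0" using s by simp
    moreover have "T \<ge> 0" unfolding T_def using s q0 by (intro sum_nonneg mult_nonneg_nonneg) auto
    ultimately show ?thesis by (simp add: K_def)
  next
    case False
    have "0 < q s * (w s)\<^sup>2" using False q[OF s(1)] by simp
    also have "\<dots> \<le> T"
      unfolding T_def using s q0
      by (intro member_le_sum[of s _ "\<lambda>i. q i * (w i)\<^sup>2"] mult_nonneg_nonneg) auto
    also have "\<dots> \<le> K" using s by (simp add: K_def)
    finally show ?thesis .
  qed
  \<comment> \<open>The scale that meets the constraint: the weighted mean of
    \<open>w i * y i\<close> comes out as \<open>- \<mu> * K\<close>.\<close>
  define \<mu> where "\<mu> = b / K"
  have \<mu>: "\<mu> > 0" using b K by (simp add: \<mu>_def)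
  define y where "y = (\<lambda>i. \<mu> * (if i \<in> {s..n} then \<theta> - w i else 0))"
  have y0: "y i \<ge> 0" for i
  proof (cases "i \<in> {s..n}")
    case True
    with above[OF True] \<mu> show ?thesis
      by (simp add: y_def \<theta>_def less_imp_le del: atLeastAtMost_iff minus_divide_left)
  qed (auto simp: y_def)
  have wmean_y: "wmean ?I q (\<lambda>i. f i * y i) = \<mu> * (\<Sum>i = s..n. q i * (f i * (\<theta> - w i)))" for f
  proof -
    have sub: "{s..n} \<subseteq> ?I" using s by auto
    have "wmean ?I q (\<lambda>i. f i * y i) = (\<Sum>i = s..n. q i * (f i * y i))"
      unfolding wmean_def by (rule sum.mono_neutral_right) (use sub in \<open>auto simp: y_def\<close>)
    also have "\<dots> = (\<Sum>i = s..n. \<mu> * (q i * (f i * (\<theta> - w i))))"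
      by (intro sum.cong refl) (auto simp: y_def)
    finally show ?thesis by (simp add: sum_distrib_left)
  qed
  have mean_y: "wmean ?I q y = \<mu> * \<theta>"
  proof -
    have "(\<Sum>i = s..n. q i * (\<theta> - w i)) = \<theta> * P - S"
      by (simp add: P_def S_def sum_subtractf sum_distrib_left algebra_simps)
    then show ?thesis using wmean_y[of "\<lambda>_. 1"] \<theta>P by simp
  qed
  have wy: "wmean ?I q (\<lambda>i. w i * y i) = - b"
  proof -
    have "(\<Sum>i = s..n. q i * (w i * (\<theta> - w i))) = \<theta> * S - T"
      by (simp add: T_def S_def sum_subtractf sum_distrib_left algebra_simps power2_eq_square)
    also have "\<dots> = - K" by (simp add: K\<theta>)
    finally show ?thesis unfolding wmean_y using K by (simp add: \<mu>_def)
  qed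
  \<comment> \<open>Complementary slackness: each \<open>y i\<close> is 0 or equals
    \<open>\<mu> * (\<theta> - w i)\<close>, so its square is linear in \<open>y i\<close> and
    \<open>w i * y i\<close>. After subtracting the squared mean only the constraint term is
    left.\<close>
  have "wmean ?I q (\<lambda>i. (y i)\<^sup>2) = \<mu> * \<theta> * wmean ?I q y - \<mu> * wmean ?I q (\<lambda>i. w i * y i)"
    unfolding wmean_linear(2,3)[symmetric] unfolding wmean_def
    by (intro sum.cong refl) (simp add: y_def power2_eq_square algebra_simps)
  then have "(wsd ?I q y)\<^sup>2 = \<mu> * b"
    using wsd_power2[of q ?I y] q1 q0 unfolding mean_y wy by (simp add: power2_eq_square)
  moreover have sd0: "wsd ?I q y \<ge> 0"
    unfolding wsd_def by (intro real_sqrt_ge_zero sum_nonneg mult_nonneg_nonneg q0) auto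
  ultimately have sdy: "wsd ?I q y = sqrt (\<mu> * b)"
    by (metis abs_of_nonneg real_sqrt_abs)
  also have "\<dots> = b / sqrt K"
    using b by (simp add: \<mu>_def real_sqrt_divide real_sqrt_mult)
  finally have sdy': "wsd ?I q y = b / sqrt K" .
  show "\<exists>y. (\<forall>i. y i \<ge> 0) \<and> wmean {1..n} q (\<lambda>i. w i * y i) = - b \<and>
      wsd {1..n} q y = b / sqrt (T + S\<^sup>2 / (1 - P))"
    using y0 wy sdy' unfolding K_def by blast
  assume x0: "\<And>i. i \<in> ?I \<Longrightarrow> x i \<ge> 0" and wx: "wmean ?I q (\<lambda>i. w i * x i) = - b"
  \<comment> \<open>Pointwise, \<open>y i - \<mu> * \<theta>\<close> is at least
    \<open>- \<mu> * w i\<close>, with equality from \<open>s\<close> on; before \<open>s\<close>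
    this is \<open>below\<close>. Multiplication by \<open>x i\<close> keeps the direction because
    \<open>x i\<close> is nonnegative.\<close>
  have "- \<mu> * wmean ?I q (\<lambda>i. w i * x i) \<le> wmean ?I q (\<lambda>i. x i * (y i - \<mu> * \<theta>))"
    unfolding wmean_linear(3)[symmetric] unfolding wmean_def
  proof (intro sum_mono mult_left_mono)
    fix i assume i: "i \<in> ?I"
    have "- \<mu> * w i \<le> y i - \<mu> * \<theta>"
    proof (cases "s \<le> i")
      case True
      with i show ?thesis by (simp add: y_def algebra_simps)
    next
      case False
      then have "\<mu> * \<theta> \<le> \<mu> * w i"
        using i below[of i] \<mu> unfolding \<theta>_def by (intro mult_left_mono) auto
      with False show ?thesis by (simp add: y_def)
    qed
    then have "x i * (- \<mu> * w i) \<le> x i * (y i - \<mu> * \<theta>)"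
      using x0[OF i] by (rule mult_left_mono)
    then show "- \<mu> * (w i * x i) \<le> x i * (y i - \<mu> * \<theta>)" by (simp add: algebra_simps)
    show "0 \<le> q i" using q0[OF i] .
  qed
  also have "\<dots> = wmean ?I q (\<lambda>i. x i * y i) - wmean ?I q x * wmean ?I q y"
    unfolding mean_y
    by (simp add: right_diff_distrib wmean_linear mult.commute[of _ "\<mu> * \<theta>"])
  also have "\<dots> \<le> wsd ?I q x * wsd ?I q y"
    using wcov_le[of q ?I x y] q1 q0 by simp
  finally have "\<mu> * b \<le> wsd ?I q x * sqrt (\<mu> * b)"
    unfolding wx sdy by simp
  then have "sqrt (\<mu> * b) * sqrt (\<mu> * b) \<le> wsd ?I q x * sqrt (\<mu> * b)"
    using \<mu> b by simp
  then have "sqrt (\<mu> * b) \<le> wsd ?I q x"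
    using mult_pos_pos[OF \<mu> b] by (subst (asm) mult_le_cancel_right) auto
  then show "b / sqrt (T + S\<^sup>2 / (1 - P)) \<le> wsd ?I q x"
    using sdy sdy' by (simp add: K_def)
qed

subsection \<open>Means conditional on the treatments\<close>

lemma cond_mean_cong:
  assumes "\<And>\<omega>. \<omega> \<in> A \<Longrightarrow> X \<omega> = X' \<omega>"
  shows "cond_mean M A X = cond_mean M A X'"
proof -
  have "(LINT \<omega>:A|M. X \<omega>) = (LINT \<omega>:A|M. X' \<omega>)"
    unfolding set_lebesgue_integral_def using assms
    by (intro Bochner_Integration.integral_cong[OF refl]) (auto simp: indicator_def)
  then show ?thesis by (simp add: cond_mean_def)
qed

lemma cond_mean_cmult: "cond_mean M A (\<lambda>\<omega>. k * X \<omega>) = k * cond_mean M A X"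
  by (simp add: cond_mean_def)

lemma cond_mean_add:
  assumes "A \<in> sets M" "integrable M X" "integrable M X'"
  shows "cond_mean M A (\<lambda>\<omega>. X \<omega> + X' \<omega>) = cond_mean M A X + cond_mean M A X'"
proof -
  have "set_integrable M A X" "set_integrable M A X'"
    unfolding set_integrable_def
    by (rule integrable_mult_indicator[OF assms(1) assms(2)],
        rule integrable_mult_indicator[OF assms(1) assms(3)])
  then show ?thesis
    by (simp add: cond_mean_def set_integral_add add_divide_distrib)
qed

lemma cond_mean_diff:
  assumes "A \<in> sets M" "integrable M X" "integrable M X'"
  shows "cond_mean M A (\<lambda>\<omega>. X \<omega> - X' \<omega>) = cond_mean M A X - cond_mean M A X'"
  using cond_mean_add[of A M X "\<lambda>\<omega>. (-1) * X' \<omega>"] cond_mean_cmult[of M A "-1" X'] assms by simp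

lemma cond_mean_sum:
  assumes "A \<in> sets M" "finite I" "\<And>i. i \<in> I \<Longrightarrow> integrable M (X i)"
  shows "cond_mean M A (\<lambda>\<omega>. \<Sum>i\<in>I. X i \<omega>) = (\<Sum>i\<in>I. cond_mean M A (X i))"
  using assms(2,3)
proof (induction I rule: finite_induct)
  case empty
  show ?case using cond_mean_cmult[of M A 0 "\<lambda>_. 0"] by simp
next
  case (insert i I)
  then show ?case by (simp add: cond_mean_add[OF assms(1)])
qed

text \<open>Transfers almost sure hypotheses to the realization: a property determined by the
  treatment array is constant on the event, so one good sample point suffices.\<close>

lemma (in prob_space) AE_obtain_in_event:
  assumes "AE \<omega> in M. Q \<omega>" "A \<in> events" "prob A > 0"
  obtains \<omega> where "\<omega> \<in> A" "Q \<omega>"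
proof -
  have "\<not> (AE \<omega> in M. \<omega> \<notin> A)" using assms(2,3) prob_eq_0 by force
  with assms(1) have "\<exists>\<omega>\<in>A. Q \<omega>" by (metis (mono_tags, lifting) AE_mp AE_I2)
  with that show ?thesis by blast
qed

text \<open>Passing from the event of index \<open>k\<close> to the joint event multiplies both the
  integral and the probability by the same product over the other indices. \<open>mean\<close> is
  stated without division, so it makes sense even for a null event.\<close>

lemma (in prob_space) indep_vars_integral_indicator:
  fixes V :: "'i \<Rightarrow> 'a \<Rightarrow> 'b" and f :: "'b \<Rightarrow> real"
  assumes indep: "indep_vars M' V I" and I: "finite I" "k \<in> I"
    and E: "\<And>i. i \<in> I \<Longrightarrow> E i \<in> sets (M' i)"
    and f: "f \<in> borel_measurable (M' k)" "integrable M (\<lambda>\<omega>. f (V k \<omega>))"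
    and mean: "(LINT \<omega>:{\<omega> \<in> space M. V k \<omega> \<in> E k}|M. f (V k \<omega>))
        = prob {\<omega> \<in> space M. V k \<omega> \<in> E k} * c"
  shows "(LINT \<omega>:{\<omega> \<in> space M. \<forall>i\<in>I. V i \<omega> \<in> E i}|M. f (V k \<omega>))
        = prob {\<omega> \<in> space M. \<forall>i\<in>I. V i \<omega> \<in> E i} * c"
proof -
  have V: "V i \<in> measurable M (M' i)" if "i \<in> I" for i
    using indep that by (simp add: indep_vars_def)
  have ev: "{\<omega> \<in> space M. V i \<omega> \<in> E i} \<in> events" if "i \<in> I" for i
    using measurable_sets[OF V[OF that] E[OF that]]
    by (simp add: vimage_def Int_def conj_commute)
  \<comment> \<open>Kept general in \<open>h\<close> to be used twice: with \<open>f\<close> for the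
    integral and with the constant 1 for the probability.\<close>
  have prod: "(LINT \<omega>:{\<omega> \<in> space M. \<forall>i\<in>I. V i \<omega> \<in> E i}|M. h (V k \<omega>))
      = (LINT \<omega>:{\<omega> \<in> space M. V k \<omega> \<in> E k}|M. h (V k \<omega>))
        * (\<Prod>i\<in>I - {k}. prob {\<omega> \<in> space M. V i \<omega> \<in> E i})"
    if h: "h \<in> borel_measurable (M' k)" "integrable M (\<lambda>\<omega>. h (V k \<omega>))" for h :: "'b \<Rightarrow> real"
  proof -
    \<comment> \<open>Each factor depends on \<open>V i\<close> alone, so the factors inherit
      independence; the integrand is their product.\<close>
    define X where "X = (\<lambda>i v. indicator (E i) v * (if i = k then h v else 1) :: real)"
    have X: "X i \<in> borel_measurable (M' i)" if "i \<in> I" for i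
      using E[OF that] h(1) by (cases "i = k") (simp_all add: X_def)
    have ind: "indep_vars (\<lambda>_. borel) (\<lambda>i \<omega>. X i (V i \<omega>)) I"
      by (rule indep_vars_compose2[OF indep]) (rule X)
    have ind_eq: "X i (V i \<omega>) = indicator {\<omega> \<in> space M. V i \<omega> \<in> E i} \<omega> * (if i = k then h (V i \<omega>) else 1)"
      if "\<omega> \<in> space M" for i \<omega>
      using that by (simp add: X_def indicator_def)
    have int_k: "integrable M (\<lambda>\<omega>. indicator {\<omega> \<in> space M. V k \<omega> \<in> E k} \<omega> * h (V k \<omega>))"
      using integrable_mult_indicator[OF ev[OF I(2)] h(2)] by simp
    have int: "integrable M (\<lambda>\<omega>. X i (V i \<omega>))" if "i \<in> I" for i
    proof -
      have "integrable M (\<lambda>\<omega>. indicator {\<omega> \<in> space M. V i \<omega> \<in> E i} \<omega> * (if i = k then h (V i \<omega>) else 1))"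
        using int_k ev[OF that] by (cases "i = k") (simp_all add: less_top[symmetric])
      then show ?thesis
        by (subst Bochner_Integration.integrable_cong[OF refl ind_eq]) auto
    qed
    have "(LINT \<omega>:{\<omega> \<in> space M. \<forall>i\<in>I. V i \<omega> \<in> E i}|M. h (V k \<omega>))
        = (LINT \<omega>|M. (\<Prod>i\<in>I. X i (V i \<omega>)))"
      unfolding set_lebesgue_integral_def
    proof (intro Bochner_Integration.integral_cong refl)
      fix \<omega> assume \<omega>: "\<omega> \<in> space M"
      have "(\<Prod>i\<in>I. X i (V i \<omega>))
          = (\<Prod>i\<in>I. indicator (E i) (V i \<omega>)) * (\<Prod>i\<in>I. if i = k then h (V i \<omega>) else 1)"
        by (simp add: X_def prod.distrib)
      also have "(\<Prod>i\<in>I. if i = k then h (V i \<omega>) else 1) = h (V k \<omega>)"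
        using I by (simp add: prod.delta)
      also have "(\<Prod>i\<in>I. indicator (E i) (V i \<omega>) :: real) = of_bool (\<forall>i\<in>I. V i \<omega> \<in> E i)"
        using I(1) by (induction I rule: finite_induct) auto
      finally show "indicator {\<omega> \<in> space M. \<forall>i\<in>I. V i \<omega> \<in> E i} \<omega> *\<^sub>R h (V k \<omega>)
          = (\<Prod>i\<in>I. X i (V i \<omega>))"
        using \<omega> by simp
    qed
    also have "\<dots> = (\<Prod>i\<in>I. LINT \<omega>|M. X i (V i \<omega>))"
      by (rule indep_vars_lebesgue_integral[OF I(1) ind int])
    also have "\<dots> = (LINT \<omega>|M. X k (V k \<omega>)) * (\<Prod>i\<in>I - {k}. LINT \<omega>|M. X i (V i \<omega>))"
      using I by (simp add: prod.remove)
    also have "(LINT \<omega>|M. X k (V k \<omega>)) = (LINT \<omega>:{\<omega> \<in> space M. V k \<omega> \<in> E k}|M. h (V k \<omega>))"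
      unfolding set_lebesgue_integral_def
      by (intro Bochner_Integration.integral_cong refl) (simp add: ind_eq)
    also have "(\<Prod>i\<in>I - {k}. LINT \<omega>|M. X i (V i \<omega>))
        = (\<Prod>i\<in>I - {k}. prob {\<omega> \<in> space M. V i \<omega> \<in> E i})"
    proof (intro prod.cong refl)
      fix i assume i: "i \<in> I - {k}"
      have "(LINT \<omega>|M. X i (V i \<omega>)) = (LINT \<omega>|M. indicator {\<omega> \<in> space M. V i \<omega> \<in> E i} \<omega>)"
        using i by (intro Bochner_Integration.integral_cong refl) (simp add: ind_eq)
      then show "(LINT \<omega>|M. X i (V i \<omega>)) = prob {\<omega> \<in> space M. V i \<omega> \<in> E i}"
        using ev[of i] i by simp
    qed
    finally show ?thesis .
  qed
  have evI: "{\<omega> \<in> space M. \<forall>i\<in>I. V i \<omega> \<in> E i} \<in> events"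
    using I ev by (intro sets.sets_Collect_finite_All') auto
  have one: "(LINT \<omega>:B|M. (1::real)) = prob B" if "B \<in> events" for B
    using that by (simp add: set_lebesgue_integral_def)
  have "(LINT \<omega>:{\<omega> \<in> space M. \<forall>i\<in>I. V i \<omega> \<in> E i}|M. (1::real))
      = (LINT \<omega>:{\<omega> \<in> space M. V k \<omega> \<in> E k}|M. 1)
        * (\<Prod>i\<in>I - {k}. prob {\<omega> \<in> space M. V i \<omega> \<in> E i})"
    by (rule prod[of "\<lambda>_. 1"]) simp_all
  then have "prob {\<omega> \<in> space M. \<forall>i\<in>I. V i \<omega> \<in> E i}
      = prob {\<omega> \<in> space M. V k \<omega> \<in> E k}
        * (\<Prod>i\<in>I - {k}. prob {\<omega> \<in> space M. V i \<omega> \<in> E i})"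
    unfolding one[OF evI] one[OF ev[OF I(2)]] .
  then show ?thesis
    unfolding prod[OF f] mean by (simp only: mult_ac)
qed

text \<open>Brings exogeneity into the division-free form that the factorization over groups
  expects.\<close>

lemma (in prob_space) cond_exp_AE_const_integral:
  assumes sub: "subalgebra M F" and f: "integrable M f" and B: "B \<in> sets F"
    and const: "AE \<omega> in M. real_cond_exp M F f \<omega> = c"
  shows "(LINT \<omega>:B|M. f \<omega>) = prob B * c"
proof -
  interpret finite_measure_subalgebra M F
    by unfold_locales (rule sub)
  have BM: "B \<in> events" using sub B by (auto simp: subalgebra_def)
  have "(LINT \<omega>:B|M. f \<omega>) = (LINT \<omega>:B|M. real_cond_exp M F f \<omega>)"
    by (rule real_cond_exp_intA[OF f B])
  also have "\<dots> = (LINT \<omega>:B|M. c)"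
    using const BM by (intro set_lebesgue_integral_cong_AE) auto
  also have "\<dots> = prob B * c"
    using BM by (simp add: set_lebesgue_integral_def)
  finally show ?thesis .
qed

text \<open>An average of 0 or 1 is extremal, so no observation can deviate from it. Hence every
  point of the event has a sharp design once \<open>d\<close> is binary, without an exceptional null
  set.\<close>

lemma cell_avg_of_bool_eq:
  assumes "N g t > 0" and avg: "cell_avg N (\<lambda>i g t \<omega>. of_bool (D i g t \<omega>)) g t \<omega> \<in> {0, 1}"
    and i: "i \<in> {1..N g t}"
  shows "D i g t \<omega> \<longleftrightarrow> cell_avg N (\<lambda>i g t \<omega>. of_bool (D i g t \<omega>)) g t \<omega> = 1"
proof (cases "cell_avg N (\<lambda>i g t \<omega>. of_bool (D i g t \<omega>)) g t \<omega> = 1")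
  case True
  then have "(\<Sum>i = 1..N g t. 1 - of_bool (D i g t \<omega>) :: real) = 0"
    using assms(1) by (simp add: cell_avg_def sum_subtractf)
  then have "1 - of_bool (D i g t \<omega>) = (0::real)"
    using i by (subst (asm) sum_nonneg_eq_0_iff) auto
  with True show ?thesis by (simp split: if_splits)
next
  case False
  then have "(\<Sum>i = 1..N g t. of_bool (D i g t \<omega>) :: real) = 0"
    using assms(1) avg by (simp add: cell_avg_def)
  then have "of_bool (D i g t \<omega>) = (0::real)"
    using i by (subst (asm) sum_nonneg_eq_0_iff) auto
  with False show ?thesis by simp
qed

text \<open>Group 1 is the reference: equal increments freeze each group's gap to it at its period-1
  value.\<close>

lemma parallel_paths_additive:
  fixes y :: "nat \<Rightarrow> nat \<Rightarrow> real"
  assumes "\<And>g g' t. g \<in> {1..G} \<Longrightarrow> g' \<in> {1..G} \<Longrightarrow> t \<in> {2..T} \<Longrightarrow>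
      y g t - y g (t - 1) = y g' t - y g' (t - 1)"
  shows "\<exists>a c. \<forall>g\<in>{1..G}. \<forall>t\<in>{1..T}. y g t = a g + c t"
proof -
  have "y g t = (y g 1 - y 1 1) + y 1 t" if g: "g \<in> {1..G}" and t: "t \<in> {1..T}" for g t
  proof -
    from t have "1 \<le> t" "t \<le> T" by auto
    then show ?thesis
    proof (induction t rule: dec_induct)
      case base
      then show ?case by simp
    next
      case (step t)
      with assms[of g 1 "Suc t"] g show ?case by simp
    qed
  qed
  then show ?thesis
    by (rule_tac x = "\<lambda>g. y g 1 - y 1 1" in exI, rule_tac x = "\<lambda>t. y 1 t" in exI) blast
qed

subsection \<open>The coefficient as a weighted sum of treatment effects\<close>

text \<open>A binary \<open>d\<close> is its own indicator, which turns sums over treated cells into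
  the full double sums to which orthogonality applies.\<close>

lemma sum_treated_cells:
  assumes bin: "\<And>g t. g \<in> {1..G} \<Longrightarrow> t \<in> {1..T} \<Longrightarrow> d g t \<in> {0, 1}"
  shows "(\<Sum>(g, t)\<in>treated_cells G T d. f g t) = (\<Sum>g = 1..G. \<Sum>t = 1..T. d g t * f g t)"
proof -
  have "(\<Sum>g = 1..G. \<Sum>t = 1..T. d g t * f g t)
      = (\<Sum>(g, t)\<in>{1..G} \<times> {1..T}. d g t * f g t)"
    by (rule sum.cartesian_product)
  also have "\<dots> = (\<Sum>(g, t)\<in>treated_cells G T d. d g t * f g t)"
  proof (rule sum.mono_neutral_right)
    show "\<forall>i\<in>{1..G} \<times> {1..T} - treated_cells G T d. (case i of (g, t) \<Rightarrow> d g t * f g t) = 0"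
      using bin by (force simp: treated_cells_def simp del: One_nat_def)
  qed (auto simp: treated_cells_def)
  also have "\<dots> = (\<Sum>(g, t)\<in>treated_cells G T d. f g t)"
    by (intro sum.cong) (auto simp: treated_cells_def)
  finally show ?thesis ..
qed

lemma treated_mean_eq:
  assumes "\<And>g t. g \<in> {1..G} \<Longrightarrow> t \<in> {1..T} \<Longrightarrow> d g t \<in> {0, 1}"
  shows "treated_mean N G T d x
    = (\<Sum>g = 1..G. \<Sum>t = 1..T. real (N g t) * d g t * x g t) / num_treated N G T d"
  unfolding treated_mean_def
  by (subst sum_treated_cells[where d = d, OF assms]) (simp_all add: sum_divide_distrib mult_ac)

lemma num_treated_pos:
  assumes bin: "\<And>g t. g \<in> {1..G} \<Longrightarrow> t \<in> {1..T} \<Longrightarrow> d g t \<in> {0, 1}"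
    and N: "\<And>g t. g \<in> {1..G} \<Longrightarrow> t \<in> {1..T} \<Longrightarrow> N g t > 0"
    and nc: "\<not> fe_collinear G T d"
  shows "num_treated N G T d > 0"
proof (rule ccontr)
  assume "\<not> num_treated N G T d > 0"
  moreover have "num_treated N G T d = (\<Sum>g = 1..G. \<Sum>t = 1..T. real (N g t) * (d g t)\<^sup>2)"
    unfolding num_treated_def using bin by (intro sum.cong refl) (force simp del: One_nat_def)
  ultimately have "d g t = 0" if "g \<in> {1..G}" "t \<in> {1..T}" for g t
    using weighted_sum_squares_eq_0[where f = d, OF N _ that] by simp
  then have "\<forall>g\<in>{1..G}. \<forall>t\<in>{1..T}. d g t = 0 + 0" by simp
  then show False
    using nc unfolding fe_collinear_def by meson
qed

text \<open>The normalizing sum over treated cells is, up to the number of treated observations, the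
  denominator of the regression coefficient; this links the weights to the regression.\<close>

lemma fe_weight_eq:
  assumes bin: "\<And>g t. g \<in> {1..G} \<Longrightarrow> t \<in> {1..T} \<Longrightarrow> d g t \<in> {0, 1}"
  shows "fe_weight N G T d g t = num_treated N G T d * fe_resid N G T d g t /
    (\<Sum>g = 1..G. \<Sum>t = 1..T. real (N g t) * fe_resid N G T d g t * d g t)"
proof -
  have "(\<Sum>(g, t)\<in>treated_cells G T d. real (N g t) / num_treated N G T d * fe_resid N G T d g t)
      = (\<Sum>g = 1..G. \<Sum>t = 1..T. real (N g t) * fe_resid N G T d g t * d g t) / num_treated N G T d"
    by (subst sum_treated_cells[where d = d, OF bin]) (simp_all add: sum_divide_distrib mult_ac)
  then show ?thesis by (simp add: fe_weight_def)
qed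

lemma treated_mean_weight:
  assumes bin: "\<And>g t. g \<in> {1..G} \<Longrightarrow> t \<in> {1..T} \<Longrightarrow> d g t \<in> {0, 1}"
    and N: "\<And>g t. g \<in> {1..G} \<Longrightarrow> t \<in> {1..T} \<Longrightarrow> N g t > 0"
    and nc: "\<not> fe_collinear G T d"
  shows "treated_mean N G T d (\<lambda>g t. fe_weight N G T d g t * x g t)
    = (\<Sum>g = 1..G. \<Sum>t = 1..T. real (N g t) * fe_resid N G T d g t * d g t * x g t) /
      (\<Sum>g = 1..G. \<Sum>t = 1..T. real (N g t) * fe_resid N G T d g t * d g t)"
    (is "_ = _ / ?Q")
proof -
  have W: "fe_weight N G T d g t = num_treated N G T d * fe_resid N G T d g t / ?Q" for g t
    by (rule fe_weight_eq[OF bin])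
  have N1: "num_treated N G T d > 0" by (rule num_treated_pos[OF bin N nc])
  have "(\<Sum>g = 1..G. \<Sum>t = 1..T. real (N g t) * d g t * (fe_weight N G T d g t * x g t))
      = num_treated N G T d / ?Q *
        (\<Sum>g = 1..G. \<Sum>t = 1..T. real (N g t) * fe_resid N G T d g t * d g t * x g t)"
    unfolding sum_distrib_left W by (simp add: mult_ac)
  then show ?thesis
    using N1 by (subst treated_mean_eq[OF bin]) simp_all
qed

text \<open>On the event the treatment averages are known to equal \<open>d\<close> only inside the
  panel, so the two arrays need not coincide as functions.\<close>

lemma beta_fe_cong:
  assumes "\<And>g t. g \<in> {1..G} \<Longrightarrow> t \<in> {1..T} \<Longrightarrow> d g t = d' g t"
  shows "beta_fe N G T y d = beta_fe N G T y d'"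
proof -
  have "fe_ssr N G T y d = fe_ssr N G T y d'"
    unfolding fe_ssr_def using assms by (intro ext sum.cong refl) auto
  then show ?thesis by (simp add: beta_fe_def)
qed

lemma beta_fe_hat_eq:
  assumes bin: "\<And>g t. g \<in> {1..G} \<Longrightarrow> t \<in> {1..T} \<Longrightarrow> d g t \<in> {0, 1}"
    and N: "\<And>g t. g \<in> {1..G} \<Longrightarrow> t \<in> {1..T} \<Longrightarrow> N g t > 0"
    and nc: "\<not> fe_collinear G T d"
    and avg: "\<And>g t. g \<in> {1..G} \<Longrightarrow> t \<in> {1..T} \<Longrightarrow> treat_avg N D g t \<omega> = d g t"
  shows "beta_fe_hat N G T D Y \<omega> =
    (\<Sum>g = 1..G. \<Sum>t = 1..T. real (N g t) * fe_resid N G T d g t *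
        (pot_avg N Y False g t \<omega> + d g t * cell_ate N Y g t \<omega>)) /
    (\<Sum>g = 1..G. \<Sum>t = 1..T. real (N g t) * fe_resid N G T d g t * d g t)"
proof -
  have cell: "(\<Sum>i = 1..N g t. Y i g t (D i g t \<omega>) \<omega>)
      = real (N g t) * (pot_avg N Y False g t \<omega> + d g t * cell_ate N Y g t \<omega>)"
    if gt: "g \<in> {1..G}" "t \<in> {1..T}" for g t
  proof -
    have D: "D i g t \<omega> \<longleftrightarrow> d g t = 1" if "i \<in> {1..N g t}" for i
      using cell_avg_of_bool_eq[of N g t D \<omega> i] N[OF gt] avg[OF gt] bin[OF gt] that
      by (simp add: treat_avg_def)
    have "(\<Sum>i = 1..N g t. Y i g t (D i g t \<omega>) \<omega>)
        = (\<Sum>i = 1..N g t. Y i g t False \<omega> + d g t * (Y i g t True \<omega> - Y i g t False \<omega>))"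
      using D bin[OF gt] by (intro sum.cong refl) auto
    then show ?thesis
      using N[OF gt]
      by (simp add: pot_avg_def cell_ate_def cell_avg_def sum.distrib sum_distrib_left[symmetric]
          distrib_left)
  qed
  have "beta_fe_hat N G T D Y \<omega> = beta_fe N G T (\<lambda>i g t. Y i g t (D i g t \<omega>) \<omega>) d"
    unfolding beta_fe_hat_def by (rule beta_fe_cong) (rule avg)
  also have "\<dots> = (\<Sum>g = 1..G. \<Sum>t = 1..T. fe_resid N G T d g t *
        (\<Sum>i = 1..N g t. Y i g t (D i g t \<omega>) \<omega>)) /
    (\<Sum>g = 1..G. \<Sum>t = 1..T. real (N g t) * fe_resid N G T d g t * d g t)"
    by (rule beta_fe_eq[OF N nc])
  also have "(\<Sum>g = 1..G. \<Sum>t = 1..T. fe_resid N G T d g t *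
        (\<Sum>i = 1..N g t. Y i g t (D i g t \<omega>) \<omega>))
     = (\<Sum>g = 1..G. \<Sum>t = 1..T. real (N g t) * fe_resid N G T d g t *
        (pot_avg N Y False g t \<omega> + d g t * cell_ate N Y g t \<omega>))"
    using cell by (intro sum.cong refl) simp
  finally show ?thesis .
qed

lemma att_eq:
  assumes N: "\<And>g t. g \<in> {1..G} \<Longrightarrow> t \<in> {1..T} \<Longrightarrow> N g t > 0"
    and avg: "\<And>g t. g \<in> {1..G} \<Longrightarrow> t \<in> {1..T} \<Longrightarrow> treat_avg N D g t \<omega> = d g t"
  shows "att N G T D Y \<omega> = treated_mean N G T d (\<lambda>g t. cell_ate N Y g t \<omega>)"
proof -
  have "treated_cells G T (\<lambda>g t. treat_avg N D g t \<omega>) = treated_cells G T d"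
    unfolding treated_cells_def using avg by auto
  moreover have "num_treated N G T (\<lambda>g t. treat_avg N D g t \<omega>) = num_treated N G T d"
    unfolding num_treated_def using avg by (intro sum.cong refl) auto
  moreover have "(\<Sum>i = 1..N g t. Y i g t True \<omega> - Y i g t False \<omega>)
      = real (N g t) * cell_ate N Y g t \<omega>" if "(g, t) \<in> treated_cells G T d" for g t
    using N[of g t] that by (simp add: treated_cells_def cell_ate_def cell_avg_def)
  ultimately show ?thesis
    unfolding att_def treated_mean_def sum_divide_distrib
    by (intro sum.cong) auto
qed

section \<open>Measurability, integrability, and trends given the treatments of all groups\<close>

lemma treat_avg_measurable:
  assumes "\<And>i. i \<in> {1..N g t} \<Longrightarrow> D i g t \<in> measurable M (count_space UNIV)"
  shows "treat_avg N D g t \<in> borel_measurable M"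
proof -
  have "(\<lambda>\<omega>. of_bool (D i g t \<omega>) :: real) \<in> borel_measurable M" if "i \<in> {1..N g t}" for i
    by (rule measurable_compose[OF assms[OF that]]) simp
  then show ?thesis
    unfolding treat_avg_def cell_avg_def
    by (intro borel_measurable_divide borel_measurable_sum) simp_all
qed

lemma integrable_cell_avg:
  assumes "\<And>i. i \<in> {1..N g t} \<Longrightarrow> integrable M (f i g t)"
  shows "integrable M (cell_avg N f g t)"
  unfolding cell_avg_def
  by (rule integrable_divide, rule Bochner_Integration.integrable_sum) (rule assms)

lemma treat_event_measurable:
  assumes "\<And>g t. g \<in> {1..G} \<Longrightarrow> t \<in> {1..T} \<Longrightarrow> treat_avg N D g t \<in> borel_measurable M"
  shows "treat_event M N G T D d \<in> sets M"
  unfolding treat_event_def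
proof (intro sets.sets_Collect_finite_All finite_atLeastAtMost)
  fix g t assume "g \<in> {1..G}" "t \<in> {1..T}"
  then show "{\<omega> \<in> space M. treat_avg N D g t \<omega> = d g t} \<in> sets M"
    using assms by measurable
qed

text \<open>Exogeneity gives the mean trend on the event that group \<open>g\<close> follows its own
  path in \<open>d\<close>; independence extends it to the event that all groups do.\<close>

lemma (in prob_space) cond_mean_trend:
  fixes Y :: "nat \<Rightarrow> nat \<Rightarrow> nat \<Rightarrow> bool \<Rightarrow> 'a \<Rightarrow> real"
  assumes meas: "\<And>g t. g \<in> {1..G} \<Longrightarrow> t \<in> {1..T} \<Longrightarrow> treat_avg N D g t \<in> borel_measurable M"
    and int: "\<And>g t. g \<in> {1..G} \<Longrightarrow> t \<in> {1..T} \<Longrightarrow> integrable M (pot_avg N Y False g t)"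
    and indep: "indep_vars
          (\<lambda>_. PiM {1..T} (\<lambda>_. borel :: (real \<times> real \<times> real) measure))
          (\<lambda>g \<omega>. \<lambda>t\<in>{1..T}.
             (pot_avg N Y False g t \<omega>, pot_avg N Y True g t \<omega>, treat_avg N D g t \<omega>))
          {1..G}"
    and exog: "AE \<omega> in M. real_cond_exp M (group_treat_algebra M N T D g)
              (\<lambda>\<omega>. pot_avg N Y False g t \<omega> - pot_avg N Y False g (t - 1) \<omega>) \<omega> = c"
    and gt: "g \<in> {1..G}" "t \<in> {2..T}"
    and pos: "prob (treat_event M N G T D d) > 0"
  shows "cond_mean M (treat_event M N G T D d)
      (\<lambda>\<omega>. pot_avg N Y False g t \<omega> - pot_avg N Y False g (t - 1) \<omega>) = c"
proof -
  define V where "V = (\<lambda>g \<omega>. \<lambda>t\<in>{1..T}.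
    (pot_avg N Y False g t \<omega>, pot_avg N Y True g t \<omega>, treat_avg N D g t \<omega>))"
  let ?M = "PiM {1..T} (\<lambda>_. borel :: (real \<times> real \<times> real) measure)"
  define E where "E = (\<lambda>g. {v \<in> space ?M. \<forall>t\<in>{1..T}. snd (snd (v t)) = d g t})"
  define f where "f = (\<lambda>v::nat \<Rightarrow> real \<times> real \<times> real. fst (v t) - fst (v (t - 1)))"
  have t: "t \<in> {1..T}" "t - 1 \<in> {1..T}" using gt by auto
  have fst_meas: "fst \<in> borel_measurable (borel :: (real \<times> real \<times> real) measure)"
    by (intro borel_measurable_continuous_onI continuous_intros)
  have snd_meas: "(\<lambda>x. snd (snd x)) \<in> borel_measurable (borel :: (real \<times> real \<times> real) measure)"
    by (intro borel_measurable_continuous_onI continuous_intros)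
  have E_sets: "E g' \<in> sets ?M" for g'
    unfolding E_def
  proof (intro sets.sets_Collect_finite_All finite_atLeastAtMost)
    fix t' assume "t' \<in> {1..T}"
    then have "(\<lambda>v. v t') \<in> measurable ?M borel"
      by (rule measurable_component_singleton)
    from measurable_compose[OF this snd_meas]
    have "(\<lambda>v. snd (snd (v t'))) \<in> borel_measurable ?M" .
    then show "{v \<in> space ?M. snd (snd (v t')) = d g' t'} \<in> sets ?M" by measurable
  qed
  have f_meas: "f \<in> borel_measurable ?M"
    unfolding f_def using t
    by (intro borel_measurable_diff measurable_compose[OF _ fst_meas] measurable_component_singleton)
  have fV: "f (V g \<omega>) = pot_avg N Y False g t \<omega> - pot_avg N Y False g (t - 1) \<omega>" for \<omega>
    using t by (simp add: f_def V_def)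
  have VE: "V g' \<omega> \<in> E g' \<longleftrightarrow> (\<forall>t\<in>{1..T}. treat_avg N D g' t \<omega> = d g' t)" for g' \<omega>
    by (auto simp: E_def V_def space_PiM)
  have int_f: "integrable M (\<lambda>\<omega>. f (V g \<omega>))"
    unfolding fV using int gt(1) t by (intro Bochner_Integration.integrable_diff)
  have group_meas: "(\<lambda>\<omega>. \<lambda>t\<in>{1..T}. treat_avg N D g t \<omega>)
      \<in> measurable M (PiM {1..T} (\<lambda>_. borel))"
    using meas[OF gt(1)] by (intro measurable_restrict) simp
  have sub: "subalgebra M (group_treat_algebra M N T D g)"
    unfolding subalgebra_def group_treat_algebra_def
    using sets_image_in_sets[OF refl group_meas] by simp
  \<comment> \<open>The own-path event is defined through the bundled vector \<open>V g\<close>, but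
    exogeneity can be integrated over it only after it is recognized as an event of the treatment
    path alone.\<close>
  have B: "{\<omega> \<in> space M. V g \<omega> \<in> E g} \<in> sets (group_treat_algebra M N T D g)"
  proof -
    let ?M1 = "PiM {1..T} (\<lambda>_. borel :: real measure)"
    let ?B = "{v \<in> space ?M1. \<forall>t\<in>{1..T}. v t = d g t}"
    have "?B \<in> sets ?M1"
    proof (intro sets.sets_Collect_finite_All finite_atLeastAtMost)
      fix t' assume "t' \<in> {1..T}"
      then have "(\<lambda>v. v t') \<in> borel_measurable ?M1"
        by (rule measurable_component_singleton)
      then show "{v \<in> space ?M1. v t' = d g t'} \<in> sets ?M1" by measurable
    qed
    then have "(\<lambda>\<omega>. \<lambda>t\<in>{1..T}. treat_avg N D g t \<omega>) -` ?B \<inter> space M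
        \<in> sets (group_treat_algebra M N T D g)"
      unfolding group_treat_algebra_def by (rule in_vimage_algebra)
    also have "(\<lambda>\<omega>. \<lambda>t\<in>{1..T}. treat_avg N D g t \<omega>) -` ?B \<inter> space M
        = {\<omega> \<in> space M. V g \<omega> \<in> E g}"
      by (auto simp: VE space_PiM)
    finally show ?thesis .
  qed
  have event: "treat_event M N G T D d = {\<omega> \<in> space M. \<forall>i\<in>{1..G}. V i \<omega> \<in> E i}"
    unfolding treat_event_def VE ..
  have "(LINT \<omega>:treat_event M N G T D d|M. f (V g \<omega>)) = prob (treat_event M N G T D d) * c"
    unfolding event
  proof (rule indep_vars_integral_indicator)
    show "indep_vars (\<lambda>_. ?M) V {1..G}" using indep unfolding V_def .
    show "(LINT \<omega>:{\<omega> \<in> space M. V g \<omega> \<in> E g}|M. f (V g \<omega>)) = prob {\<omega> \<in> space M. V g \<omega> \<in> E g} * c"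
      by (rule cond_exp_AE_const_integral[OF sub int_f B]) (use exog in \<open>simp add: fV\<close>)
  qed (use gt E_sets f_meas int_f in auto)
  then show ?thesis using pos by (simp add: cond_mean_def fV)
qed

subsection \<open>Extremal treatment effects\<close>

lemma treated_mean_wmean:
  "treated_mean N G T d x
    = wmean (treated_cells G T d) (\<lambda>(g, t). real (N g t) / num_treated N G T d) (case_prod x)"
  unfolding treated_mean_def wmean_def by (intro sum.cong) auto

lemma treated_sd_wsd:
  "treated_sd N G T d x
    = wsd (treated_cells G T d) (\<lambda>(g, t). real (N g t) / num_treated N G T d) (case_prod x)"
  unfolding treated_sd_def wsd_def treated_mean_wmean[symmetric]
  by (intro arg_cong[of _ _ sqrt] sum.cong) auto

lemma wmean_reindex:
  assumes "bij_betw p J I"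
  shows "wmean I q x = wmean J (\<lambda>j. q (p j)) (\<lambda>j. x (p j))"
  unfolding wmean_def by (rule sum.reindex_bij_betw[OF assms, symmetric])

lemma wsd_reindex:
  assumes "bij_betw p J I"
  shows "wsd I q x = wsd J (\<lambda>j. q (p j)) (\<lambda>j. x (p j))"
  unfolding wsd_def wmean_reindex[OF assms, of q x]
  by (rule arg_cong[of _ _ sqrt], rule sum.reindex_bij_betw[OF assms, symmetric])

lemma wmean_cong: "(\<And>i. i \<in> I \<Longrightarrow> x i = y i) \<Longrightarrow> wmean I q x = wmean I q y"
  unfolding wmean_def by (intro sum.cong) auto

lemma wsd_cong: "(\<And>i. i \<in> I \<Longrightarrow> x i = y i) \<Longrightarrow> wsd I q x = wsd I q y"
  unfolding wsd_def using wmean_cong[of I x y q] by (auto intro!: sum.cong)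

text \<open>The enumeration transports the problem to \<open>{1..n}\<close>, and the factor
  \<open>- sgn b\<close> turns the sign condition into nonnegativity without changing the standard
  deviation. As the bound is attained for every \<open>p\<close>, its value does not depend on how
  ties are ordered.\<close>

lemma min_treated_sd_sign:
  fixes d w :: "nat \<Rightarrow> nat \<Rightarrow> real"
  assumes pos: "\<And>g t. (g, t) \<in> treated_cells G T d \<Longrightarrow> real (N g t) / num_treated N G T d > 0"
    and sum1: "(\<Sum>(g, t)\<in>treated_cells G T d. real (N g t) / num_treated N G T d) = 1"
    and w1: "treated_mean N G T d w = 1"
    and neg: "\<exists>(g, t)\<in>treated_cells G T d. w g t < 0"
    and p: "decreasing_enum G T d w p"
    and b: "b \<noteq> 0"
  shows "(\<And>g t. (g, t) \<in> treated_cells G T d \<Longrightarrow> different_sign (x g t) b) \<Longrightarrow>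
      treated_mean N G T d (\<lambda>g t. w g t * x g t) = b \<Longrightarrow>
      sigma_lower2 N G T d p w b \<le> treated_sd N G T d x"
    and "\<exists>x. (\<forall>g t. different_sign (x g t) b) \<and>
      treated_mean N G T d (\<lambda>g t. w g t * x g t) = b \<and>
      treated_sd N G T d x = sigma_lower2 N G T d p w b"
proof -
  define n where "n = card (treated_cells G T d)"
  define q where "q = (\<lambda>i. real (case_prod N (p i)) / num_treated N G T d)"
  define v where "v = (\<lambda>i. case_prod w (p i))"
  have bij: "bij_betw p {1..n} (treated_cells G T d)"
    and dec: "\<And>i j. 1 \<le> i \<Longrightarrow> i \<le> j \<Longrightarrow> j \<le> n \<Longrightarrow> v j \<le> v i"
    using p by (auto simp: decreasing_enum_def n_def v_def)
  have mean: "treated_mean N G T d x = wmean {1..n} q (\<lambda>i. case_prod x (p i))" for x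
    unfolding treated_mean_wmean wmean_reindex[OF bij] by (simp add: q_def case_prod_beta)
  have sd: "treated_sd N G T d x = wsd {1..n} q (\<lambda>i. case_prod x (p i))" for x
    unfolding treated_sd_wsd wsd_reindex[OF bij] by (simp add: q_def case_prod_beta)
  have p_in: "p i \<in> treated_cells G T d" if "i \<in> {1..n}" for i
    using bij that by (auto simp: bij_betw_def)
  have q: "q i > 0" if "i \<in> {1..n}" for i
    using pos[of "fst (p i)" "snd (p i)"] p_in[OF that] by (simp add: q_def case_prod_beta)
  have q1: "sum q {1..n} = 1"
    using sum.reindex_bij_betw[OF bij, of "\<lambda>(g, t). real (N g t) / num_treated N G T d"] sum1
    by (simp add: q_def case_prod_beta)
  have v1: "wmean {1..n} q v = 1" using w1 unfolding mean v_def .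
  have neg': "\<exists>i\<in>{1..n}. v i < 0"
  proof -
    obtain g t where gt: "(g, t) \<in> treated_cells G T d" "w g t < 0" using neg by blast
    then obtain i where "i \<in> {1..n}" "p i = (g, t)"
      using bij unfolding bij_betw_def by (metis imageE)
    with gt(2) show ?thesis by (intro bexI[of _ i]) (simp_all add: v_def)
  qed
  define s where "s = cutoff_index N G T d p w"
  define P S Q where "P = (\<Sum>i = s..n. q i)" and "S = (\<Sum>i = s..n. q i * v i)"
    and "Q = (\<Sum>i = s..n. q i * (v i)\<^sup>2)"
  have tail: "tail_sum N G T d p (\<lambda>_ _. 1) k = (\<Sum>i = k..n. q i)"
    "tail_sum N G T d p w k = (\<Sum>i = k..n. q i * v i)"
    "tail_sum N G T d p (\<lambda>g t. (w g t)\<^sup>2) k = (\<Sum>i = k..n. q i * (v i)\<^sup>2)" for k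
    by (simp_all add: tail_sum_def q_def v_def n_def case_prod_beta)
  \<comment> \<open>In both sums the bound \<open>i\<close> is local to the summand; the lower limit
    is the outer index.\<close>
  have s_eq: "s = (LEAST i. i \<in> {1..n} \<and> i \<noteq> 1 \<and>
      v i < - (\<Sum>i = i..n. q i * v i) / (1 - (\<Sum>i = i..n. q i)))"
    by (simp only: s_def cutoff_index_def tail n_def v_def)
  have sigma: "sigma_lower2 N G T d p w b = \<bar>b\<bar> / sqrt (Q + S\<^sup>2 / (1 - P))"
    unfolding sigma_lower2_def Let_def tail s_def[symmetric] P_def S_def Q_def ..
  note cutoff = cutoff_properties[of n q v, folded s_eq, folded P_def S_def, OF q q1 v1 dec neg']
  have s2: "s \<in> {2..n}" by (rule cutoff(1))
  then have s: "s \<in> {1..n}" by auto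
  have P1: "P < 1" by (rule cutoff(2))
  have above: "v i < - S / (1 - P)" if "i \<in> {s..n}" for i
    using that by (rule cutoff(3)[rotated -1])
  have below: "- S / (1 - P) \<le> v i" if "i \<in> {1..<s}" for i
    using that by (rule cutoff(4)[rotated -1])
  have b0: "\<bar>b\<bar> > 0" using b by simp
  note min = min_sd_nonneg[of n q s v "\<bar>b\<bar>", folded P_def S_def Q_def,
      OF q q1 s P1 above below b0]
  have min1: "\<bar>b\<bar> / sqrt (Q + S\<^sup>2 / (1 - P)) \<le> wsd {1..n} q x"
    if "\<And>i. i \<in> {1..n} \<Longrightarrow> x i \<ge> 0" "wmean {1..n} q (\<lambda>i. v i * x i) = - \<bar>b\<bar>" for x
    by (rule min(1)) (use that in auto)
  have min2: "\<exists>y. (\<forall>i. y i \<ge> 0) \<and> wmean {1..n} q (\<lambda>i. v i * y i) = - \<bar>b\<bar> \<and>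
      wsd {1..n} q y = \<bar>b\<bar> / sqrt (Q + S\<^sup>2 / (1 - P))"
    by (rule min(2))
  have sgn: "- sgn b * b = - \<bar>b\<bar>" by (simp add: abs_sgn mult.commute)
  show "sigma_lower2 N G T d p w b \<le> treated_sd N G T d x"
    if x: "\<And>g t. (g, t) \<in> treated_cells G T d \<Longrightarrow> different_sign (x g t) b"
      and mx: "treated_mean N G T d (\<lambda>g t. w g t * x g t) = b" for x
  proof -
    let ?x = "\<lambda>i. case_prod x (p i)"
    have "wmean {1..n} q (\<lambda>i. v i * (- sgn b * ?x i)) = - sgn b * wmean {1..n} q (\<lambda>i. v i * ?x i)"
      unfolding wmean_linear(3)[symmetric] by (simp add: mult_ac)
    also have "wmean {1..n} q (\<lambda>i. v i * ?x i) = b"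
      using mx unfolding mean by (simp add: v_def case_prod_beta)
    finally have m: "wmean {1..n} q (\<lambda>i. v i * (- sgn b * ?x i)) = - \<bar>b\<bar>"
      unfolding sgn .
    have "- sgn b * ?x i \<ge> 0" if "i \<in> {1..n}" for i
      using x[of "fst (p i)" "snd (p i)"] p_in[OF that] b
      by (auto simp: different_sign_def case_prod_beta sgn_if)
    then have "\<bar>b\<bar> / sqrt (Q + S\<^sup>2 / (1 - P)) \<le> wsd {1..n} q (\<lambda>i. - sgn b * ?x i)"
      using m by (rule min1)
    also have "\<dots> = treated_sd N G T d x"
      unfolding wsd_scale sd using b by (simp add: abs_sgn_eq)
    finally show ?thesis unfolding sigma .
  qed
  obtain y where y: "\<And>i. y i \<ge> 0" "wmean {1..n} q (\<lambda>i. v i * y i) = - \<bar>b\<bar>"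
    "wsd {1..n} q y = \<bar>b\<bar> / sqrt (Q + S\<^sup>2 / (1 - P))"
    using min2 by blast
  \<comment> \<open>Outside the treated cells the inverse is arbitrary, but \<open>y\<close> is
    nonnegative at every index, so the sign condition holds in all cells.\<close>
  define x where "x = (\<lambda>g t. - sgn b * y (inv_into {1..n} p (g, t)))"
  have xp: "case_prod x (p i) = - sgn b * y i" if "i \<in> {1..n}" for i
    using bij_betw_inv_into_left[OF bij that] by (simp add: x_def case_prod_beta)
  have "different_sign (x g t) b" for g t
    using y(1) by (auto simp: different_sign_def x_def)
  moreover have "treated_mean N G T d (\<lambda>g t. w g t * x g t) = b"
  proof -
    have "treated_mean N G T d (\<lambda>g t. w g t * x g t)
        = wmean {1..n} q (\<lambda>i. - sgn b * (v i * y i))"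
      unfolding mean by (rule wmean_cong) (use xp in \<open>simp add: v_def case_prod_beta\<close>)
    also have "\<dots> = - sgn b * - \<bar>b\<bar>" unfolding wmean_linear(3) y(2) ..
    also have "\<dots> = b" by (simp add: sgn_mult_abs)
    finally show ?thesis .
  qed
  moreover have "treated_sd N G T d x = sigma_lower2 N G T d p w b"
  proof -
    have "treated_sd N G T d x = wsd {1..n} q (\<lambda>i. - sgn b * y i)"
      unfolding sd by (rule wsd_cong) (rule xp)
    also have "\<dots> = sigma_lower2 N G T d p w b"
      unfolding wsd_scale y(3) sigma using b by (simp add: abs_sgn_eq)
    finally show ?thesis .
  qed
  ultimately show "\<exists>x. (\<forall>g t. different_sign (x g t) b) \<and>
      treated_mean N G T d (\<lambda>g t. w g t * x g t) = b \<and>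
      treated_sd N G T d x = sigma_lower2 N G T d p w b" by blast
qed

theorem corollary1:
  fixes M :: "'a measure"
    and G T :: nat
    and N :: "nat \<Rightarrow> nat \<Rightarrow> nat"
    and D :: "nat \<Rightarrow> nat \<Rightarrow> nat \<Rightarrow> 'a \<Rightarrow> bool"
    and Y :: "nat \<Rightarrow> nat \<Rightarrow> nat \<Rightarrow> bool \<Rightarrow> 'a \<Rightarrow> real"
    and d :: "nat \<Rightarrow> nat \<Rightarrow> real"
    and A :: "'a set"
    and w \<Delta> :: "nat \<Rightarrow> nat \<Rightarrow> real"
    and \<Delta>TR \<beta> :: real
  assumes prob: "prob_space M"
    and D_meas: "\<And>i g t. g \<in> {1..G} \<Longrightarrow> t \<in> {1..T} \<Longrightarrow> i \<in> {1..N g t} \<Longrightarrow>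
          D i g t \<in> measurable M (count_space UNIV)"
    and Y_int: "\<And>i g t b. g \<in> {1..G} \<Longrightarrow> t \<in> {1..T} \<Longrightarrow> i \<in> {1..N g t} \<Longrightarrow>
          integrable M (Y i g t b)"
    and noncollinear: "AE \<omega> in M. \<not> fe_collinear G T (\<lambda>g t. treat_avg N D g t \<omega>)"
    and balanced: "\<And>g t. g \<in> {1..G} \<Longrightarrow> t \<in> {1..T} \<Longrightarrow> N g t > 0"
    and sharp: "\<And>i g t. g \<in> {1..G} \<Longrightarrow> t \<in> {1..T} \<Longrightarrow> i \<in> {1..N g t} \<Longrightarrow>
          AE \<omega> in M. of_bool (D i g t \<omega>) = treat_avg N D g t \<omega>"
    and indep_groups: "prob_space.indep_vars M
          (\<lambda>_. PiM {1..T} (\<lambda>_. borel :: (real \<times> real \<times> real) measure))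
          (\<lambda>g \<omega>. \<lambda>t\<in>{1..T}.
             (pot_avg N Y False g t \<omega>, pot_avg N Y True g t \<omega>, treat_avg N D g t \<omega>))
          {1..G}"
    and strong_exogeneity: "\<And>g t. g \<in> {1..G} \<Longrightarrow> t \<in> {2..T} \<Longrightarrow>
          AE \<omega> in M. real_cond_exp M (group_treat_algebra M N T D g)
              (\<lambda>\<omega>. pot_avg N Y False g t \<omega> - pot_avg N Y False g (t - 1) \<omega>) \<omega>
            = prob_space.expectation M
                (\<lambda>\<omega>. pot_avg N Y False g t \<omega> - pot_avg N Y False g (t - 1) \<omega>)"
    and common_trends: "\<And>g g' t. g \<in> {1..G} \<Longrightarrow> g' \<in> {1..G} \<Longrightarrow> t \<in> {2..T} \<Longrightarrow>
          prob_space.expectation M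
            (\<lambda>\<omega>. pot_avg N Y False g t \<omega> - pot_avg N Y False g (t - 1) \<omega>)
          = prob_space.expectation M
            (\<lambda>\<omega>. pot_avg N Y False g' t \<omega> - pot_avg N Y False g' (t - 1) \<omega>)"
    and A_eq: "A = treat_event M N G T D d"
    and A_pos: "measure M A > 0"
    and w_eq: "w = fe_weight N G T d"
    and \<Delta>_eq: "\<Delta> = (\<lambda>g t. cond_mean M A (cell_ate N Y g t))"
    and \<Delta>TR_eq: "\<Delta>TR = cond_mean M A (att N G T D Y)"
    and \<beta>_eq: "\<beta> = cond_mean M A (beta_fe_hat N G T D Y)"
  shows
    "(treated_sd N G T d w > 0 \<longrightarrow>
        (\<Delta>TR = 0 \<longrightarrow> treated_sd N G T d \<Delta> \<ge> \<bar>\<beta>\<bar> / treated_sd N G T d w) \<and>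
        (\<exists>x. treated_mean N G T d (\<lambda>g t. w g t * x g t) = \<beta> \<and>
             treated_mean N G T d x = 0 \<and>
             treated_sd N G T d x = \<bar>\<beta>\<bar> / treated_sd N G T d w)) \<and>
     (\<beta> \<noteq> 0 \<and> (\<exists>(g, t) \<in> treated_cells G T d. w g t < 0) \<longrightarrow>
        (\<forall>p. decreasing_enum G T d w p \<longrightarrow>
          ((\<forall>g\<in>{1..G}. \<forall>t\<in>{1..T}. different_sign (\<Delta> g t) \<beta>) \<longrightarrow>
             treated_sd N G T d \<Delta> \<ge> sigma_lower2 N G T d p w \<beta>) \<and>
          (\<exists>x. (\<forall>g\<in>{1..G}. \<forall>t\<in>{1..T}. different_sign (x g t) \<beta>) \<and>
               treated_mean N G T d (\<lambda>g t. w g t * x g t) = \<beta> \<and>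
               treated_sd N G T d x = sigma_lower2 N G T d p w \<beta>)))"
proof -
  interpret prob_space M by (rule prob)
  let ?I = "treated_cells G T d" and ?q = "\<lambda>(g, t). real (N g t) / num_treated N G T d"
  have meas: "treat_avg N D g t \<in> borel_measurable M" if "g \<in> {1..G}" "t \<in> {1..T}" for g t
    using that by (intro treat_avg_measurable D_meas)
  have A: "A \<in> events"
    unfolding A_eq by (rule treat_event_measurable) (rule meas)
  have avg: "treat_avg N D g t \<omega> = d g t" if "\<omega> \<in> A" "g \<in> {1..G}" "t \<in> {1..T}" for \<omega> g t
    using that unfolding A_eq treat_event_def by blast
  \<comment> \<open>The first observation exists in a nonempty cell; at some point of
    \<open>A\<close> its treatment indicator equals the average \<open>d g t\<close>.\<close>
  have bin: "d g t \<in> {0, 1}" if gt: "g \<in> {1..G}" "t \<in> {1..T}" for g t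
  proof -
    have "1 \<in> {1..N g t}" using balanced[OF gt] by simp
    from AE_obtain_in_event[OF sharp[OF gt this] A A_pos]
    obtain \<omega> where "\<omega> \<in> A" "of_bool (D 1 g t \<omega>) = treat_avg N D g t \<omega>" by blast
    with avg[OF _ gt, of \<omega>] show ?thesis by (cases "D 1 g t \<omega>") auto
  qed
  have nc: "\<not> fe_collinear G T d"
  proof -
    from AE_obtain_in_event[OF noncollinear A A_pos]
    obtain \<omega> where "\<omega> \<in> A" "\<not> fe_collinear G T (\<lambda>g t. treat_avg N D g t \<omega>)" by blast
    then show ?thesis using avg[of \<omega>] by (simp add: fe_collinear_def)
  qed
  have N1: "num_treated N G T d > 0"
    by (rule num_treated_pos[OF bin balanced nc])
  have int_pot: "integrable M (pot_avg N Y b g t)" if "g \<in> {1..G}" "t \<in> {1..T}" for b g t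
    unfolding pot_avg_def using Y_int[OF that] by (intro integrable_cell_avg)
  have int_ate: "integrable M (cell_ate N Y g t)" if "g \<in> {1..G}" "t \<in> {1..T}" for g t
    unfolding cell_ate_def using Y_int[OF that]
    by (intro integrable_cell_avg Bochner_Integration.integrable_diff)
  let ?e = "fe_resid N G T d" and ?y0 = "\<lambda>g t. cond_mean M A (pot_avg N Y False g t)"
  let ?Q = "\<Sum>g = 1..G. \<Sum>t = 1..T. real (N g t) * ?e g t * d g t"
  have Q: "?Q > 0" by (rule fe_resid_inner_pos[OF balanced nc])
  have trend: "?y0 g t - ?y0 g (t - 1)
      = expectation (\<lambda>\<omega>. pot_avg N Y False g t \<omega> - pot_avg N Y False g (t - 1) \<omega>)"
    if gt: "g \<in> {1..G}" "t \<in> {2..T}" for g t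
  proof -
    have "t \<in> {1..T}" "t - 1 \<in> {1..T}" using gt by auto
    then have "?y0 g t - ?y0 g (t - 1)
        = cond_mean M A (\<lambda>\<omega>. pot_avg N Y False g t \<omega> - pot_avg N Y False g (t - 1) \<omega>)"
      using gt int_pot by (intro cond_mean_diff[OF A, symmetric])
    also have "\<dots> = expectation (\<lambda>\<omega>. pot_avg N Y False g t \<omega> - pot_avg N Y False g (t - 1) \<omega>)"
      unfolding A_eq
      by (rule cond_mean_trend[OF meas int_pot indep_groups strong_exogeneity[OF gt] gt])
        (use A_pos A_eq in auto)
    finally show ?thesis .
  qed
  have "?y0 g t - ?y0 g (t - 1) = ?y0 g' t - ?y0 g' (t - 1)"
    if "g \<in> {1..G}" "g' \<in> {1..G}" "t \<in> {2..T}" for g g' t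
    unfolding trend[OF that(1,3)] trend[OF that(2,3)] by (rule common_trends[OF that])
  then obtain a c where y0: "\<And>g t. g \<in> {1..G} \<Longrightarrow> t \<in> {1..T} \<Longrightarrow> ?y0 g t = a g + c t"
    using parallel_paths_additive[of G T ?y0] by blast
  have y0_orth: "(\<Sum>g = 1..G. \<Sum>t = 1..T. real (N g t) * ?e g t * ?y0 g t) = 0"
  proof -
    have "(\<Sum>g = 1..G. \<Sum>t = 1..T. real (N g t) * ?e g t * ?y0 g t)
        = (\<Sum>g = 1..G. \<Sum>t = 1..T. real (N g t) * ?e g t * (a g + c t))"
      by (intro sum.cong refl) (simp only: y0)
    also have "\<dots> = 0"
      by (rule fe_orthogonal_sum[OF fe_resid_decomp(1)[OF balanced]])
    finally show ?thesis .
  qed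
  have weight: "treated_mean N G T d (\<lambda>g t. w g t * x g t)
      = (\<Sum>g = 1..G. \<Sum>t = 1..T. real (N g t) * ?e g t * d g t * x g t) / ?Q" for x
    unfolding w_eq by (rule treated_mean_weight[OF bin balanced nc])
  \<comment> \<open>On \<open>A\<close> the coefficient has a closed form with nonrandom residuals,
    so its conditional mean is computed term by term.\<close>
  have \<beta>: "treated_mean N G T d (\<lambda>g t. w g t * \<Delta> g t) = \<beta>"
  proof -
    have "\<beta> = cond_mean M A (\<lambda>\<omega>. (1 / ?Q) * (\<Sum>g = 1..G. \<Sum>t = 1..T. real (N g t) * ?e g t *
        (pot_avg N Y False g t \<omega> + d g t * cell_ate N Y g t \<omega>)))"
      unfolding \<beta>_eq
    proof (rule cond_mean_cong)
      fix \<omega> assume "\<omega> \<in> A"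
      then have "beta_fe_hat N G T D Y \<omega> = (\<Sum>g = 1..G. \<Sum>t = 1..T. real (N g t) * ?e g t *
        (pot_avg N Y False g t \<omega> + d g t * cell_ate N Y g t \<omega>)) / ?Q"
        by (intro beta_fe_hat_eq bin balanced nc avg)
      then show "beta_fe_hat N G T D Y \<omega> = (1 / ?Q) * (\<Sum>g = 1..G. \<Sum>t = 1..T. real (N g t) * ?e g t *
        (pot_avg N Y False g t \<omega> + d g t * cell_ate N Y g t \<omega>))" by simp
    qed
    also have "\<dots> = (1 / ?Q) * (\<Sum>g = 1..G. \<Sum>t = 1..T. real (N g t) * ?e g t *
        (?y0 g t + d g t * \<Delta> g t))"
    proof -
      have cell: "cond_mean M A (\<lambda>\<omega>. real (N g t) * ?e g t *
          (pot_avg N Y False g t \<omega> + d g t * cell_ate N Y g t \<omega>))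
          = real (N g t) * ?e g t * (?y0 g t + d g t * \<Delta> g t)"
        if "g \<in> {1..G}" "t \<in> {1..T}" for g t
        unfolding cond_mean_cmult \<Delta>_eq using int_pot[OF that] int_ate[OF that]
        by (simp add: cond_mean_add[OF A] cond_mean_cmult)
      have int: "integrable M (\<lambda>\<omega>. real (N g t) * ?e g t *
          (pot_avg N Y False g t \<omega> + d g t * cell_ate N Y g t \<omega>))"
        if "g \<in> {1..G}" "t \<in> {1..T}" for g t
        using int_pot[OF that] int_ate[OF that] by simp
      have "cond_mean M A (\<lambda>\<omega>. \<Sum>g = 1..G. \<Sum>t = 1..T. real (N g t) * ?e g t *
          (pot_avg N Y False g t \<omega> + d g t * cell_ate N Y g t \<omega>))
        = (\<Sum>g = 1..G. cond_mean M A (\<lambda>\<omega>. \<Sum>t = 1..T. real (N g t) * ?e g t *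
          (pot_avg N Y False g t \<omega> + d g t * cell_ate N Y g t \<omega>)))"
        using int by (intro cond_mean_sum[OF A] Bochner_Integration.integrable_sum) auto
      also have "\<dots> = (\<Sum>g = 1..G. \<Sum>t = 1..T. cond_mean M A (\<lambda>\<omega>. real (N g t) * ?e g t *
          (pot_avg N Y False g t \<omega> + d g t * cell_ate N Y g t \<omega>)))"
        using int by (intro sum.cong refl cond_mean_sum[OF A]) auto
      also have "\<dots> = (\<Sum>g = 1..G. \<Sum>t = 1..T. real (N g t) * ?e g t * (?y0 g t + d g t * \<Delta> g t))"
        by (intro sum.cong refl) (rule cell)
      finally show ?thesis unfolding cond_mean_cmult by simp
    qed
    also have "(\<Sum>g = 1..G. \<Sum>t = 1..T. real (N g t) * ?e g t * (?y0 g t + d g t * \<Delta> g t))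
        = (\<Sum>g = 1..G. \<Sum>t = 1..T. real (N g t) * ?e g t * ?y0 g t)
          + (\<Sum>g = 1..G. \<Sum>t = 1..T. real (N g t) * ?e g t * d g t * \<Delta> g t)"
      unfolding sum.distrib[symmetric] by (intro sum.cong refl) (simp add: algebra_simps)
    finally show ?thesis
      unfolding y0_orth weight by simp
  qed
  have \<Delta>TR: "\<Delta>TR = treated_mean N G T d \<Delta>"
  proof -
    have "\<Delta>TR = cond_mean M A (\<lambda>\<omega>. \<Sum>i\<in>?I. ?q i * (case i of (g, t) \<Rightarrow> cell_ate N Y g t \<omega>))"
      unfolding \<Delta>TR_eq
    proof (rule cond_mean_cong)
      fix \<omega> assume "\<omega> \<in> A"
      then have "att N G T D Y \<omega> = treated_mean N G T d (\<lambda>g t. cell_ate N Y g t \<omega>)"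
        by (intro att_eq balanced avg)
      then show "att N G T D Y \<omega> = (\<Sum>i\<in>?I. ?q i * (case i of (g, t) \<Rightarrow> cell_ate N Y g t \<omega>))"
        by (simp add: treated_mean_def case_prod_beta)
    qed
    also have "\<dots> = (\<Sum>i\<in>?I. cond_mean M A (\<lambda>\<omega>. ?q i * (case i of (g, t) \<Rightarrow> cell_ate N Y g t \<omega>)))"
    proof (rule cond_mean_sum[OF A])
      show "finite ?I"
        by (rule finite_subset[of _ "{1..G} \<times> {1..T}"]) (auto simp: treated_cells_def)
      fix i assume "i \<in> ?I"
      then show "integrable M (\<lambda>\<omega>. ?q i * (case i of (g, t) \<Rightarrow> cell_ate N Y g t \<omega>))"
        using int_ate by (cases i) (simp add: treated_cells_def)
    qed
    also have "\<dots> = treated_mean N G T d \<Delta>"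
      unfolding treated_mean_def cond_mean_cmult by (simp add: \<Delta>_eq case_prod_beta)
    finally show ?thesis .
  qed
  \<comment> \<open>With \<open>x\<close> constantly 1 the numerator is \<open>?Q\<close>
    itself.\<close>
  have w1: "treated_mean N G T d w = 1"
    using weight[of "\<lambda>_ _. 1"] Q by simp
  have q: "?q i > 0" if "i \<in> ?I" for i
    using that N1 balanced by (auto simp: treated_cells_def simp del: One_nat_def)
  have q1: "sum ?q ?I = 1"
  proof -
    have "sum ?q ?I = treated_mean N G T d (\<lambda>_ _. 1)"
      by (simp add: treated_mean_def)
    also have "\<dots> = 1"
      using N1 by (subst treated_mean_eq[OF bin]) (simp_all add: num_treated_def)
    finally show ?thesis .
  qed
  have split: "wmean ?I ?q (case_prod (\<lambda>g t. w g t * x g t))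
      = wmean ?I ?q (\<lambda>i. case_prod w i * case_prod x i)" for x
    by (rule wmean_cong) auto
  have part1: "(\<Delta>TR = 0 \<longrightarrow> treated_sd N G T d \<Delta> \<ge> \<bar>\<beta>\<bar> / treated_sd N G T d w) \<and>
        (\<exists>x. treated_mean N G T d (\<lambda>g t. w g t * x g t) = \<beta> \<and>
             treated_mean N G T d x = 0 \<and>
             treated_sd N G T d x = \<bar>\<beta>\<bar> / treated_sd N G T d w)"
    if "treated_sd N G T d w > 0"
  proof -
    have sd: "wsd ?I ?q (case_prod w) > 0" and mean: "wmean ?I ?q (case_prod w) = 1"
      using that w1 unfolding treated_sd_wsd treated_mean_wmean .
    have min1: "\<bar>wmean ?I ?q (\<lambda>i. case_prod w i * x i)\<bar> / wsd ?I ?q (case_prod w) \<le> wsd ?I ?q x"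
      if "wmean ?I ?q x = 0" for x
      by (rule min_sd_zero_mean(1)[OF q1 less_imp_le[OF q] mean sd that])
    obtain x where "wmean ?I ?q (\<lambda>i. case_prod w i * x i) = \<beta> \<and> wmean ?I ?q x = 0 \<and>
        wsd ?I ?q x = \<bar>\<beta>\<bar> / wsd ?I ?q (case_prod w)"
      using min_sd_zero_mean(2)[OF q1 less_imp_le[OF q] mean sd] by blast
    then have "\<exists>x. treated_mean N G T d (\<lambda>g t. w g t * x g t) = \<beta> \<and>
        treated_mean N G T d x = 0 \<and> treated_sd N G T d x = \<bar>\<beta>\<bar> / treated_sd N G T d w"
      unfolding treated_mean_wmean treated_sd_wsd split by (intro exI[of _ "curry x"]) simp
    moreover have "\<bar>\<beta>\<bar> / treated_sd N G T d w \<le> treated_sd N G T d \<Delta>" if "\<Delta>TR = 0"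
      using min1[of "case_prod \<Delta>"] that \<beta> \<Delta>TR
      unfolding treated_mean_wmean treated_sd_wsd split by simp
    ultimately show ?thesis by blast
  qed
  have part2: "((\<forall>g\<in>{1..G}. \<forall>t\<in>{1..T}. different_sign (\<Delta> g t) \<beta>) \<longrightarrow>
             treated_sd N G T d \<Delta> \<ge> sigma_lower2 N G T d p w \<beta>) \<and>
          (\<exists>x. (\<forall>g\<in>{1..G}. \<forall>t\<in>{1..T}. different_sign (x g t) \<beta>) \<and>
               treated_mean N G T d (\<lambda>g t. w g t * x g t) = \<beta> \<and>
               treated_sd N G T d x = sigma_lower2 N G T d p w \<beta>)"
    if "\<beta> \<noteq> 0" "\<exists>(g, t)\<in>?I. w g t < 0" "decreasing_enum G T d w p" for p
  proof -
    have pos: "real (N g t) / num_treated N G T d > 0" if "(g, t) \<in> ?I" for g t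
      using q[OF that] by simp
    note min = min_treated_sd_sign[OF pos q1 w1 that(2) that(3) that(1)]
    have "sigma_lower2 N G T d p w \<beta> \<le> treated_sd N G T d \<Delta>"
      if "\<forall>g\<in>{1..G}. \<forall>t\<in>{1..T}. different_sign (\<Delta> g t) \<beta>"
      by (rule min(1)) (use that \<beta> in \<open>auto simp: treated_cells_def\<close>)
    moreover obtain x where "\<forall>g t. different_sign (x g t) \<beta>"
      "treated_mean N G T d (\<lambda>g t. w g t * x g t) = \<beta>"
      "treated_sd N G T d x = sigma_lower2 N G T d p w \<beta>"
      using min(2) by blast
    ultimately show ?thesis by (intro conjI impI exI[of _ x]) simp_all
  qed
  show ?thesis
  proof (intro conjI impI allI, goal_cases)
    case 1
    with part1 show ?case by blast
  next
    case 2
    with part1 show ?case by blast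
  next
    case (3 p)
    with part2[of p] show ?case by blast
  next
    case (4 p)
    with part2[of p] show ?case by blast
  qed
qed

end
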